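(* Let $q\in\mathbb{C}\setminus\{0\}$ be not a root of unity, and let $d_0\in\mathbb{C}\setminus\{0\}$, $s,t\in\mathbb{C}$. Consider the $U_q(\mathfrak{sl}_2)$-module algebra structure on the quantum plane $\mathbb{C}_q[x,y]$ given by $$\mathsf{k}(x)=qx,\quad \mathsf{k}(y)=q^2y,\quad \mathsf{e}(x)=-qd_0^{-1}xy+sx^3,\quad \mathsf{e}(y)=-qd_0^{-1}y^2+tx^4,$$ $$\mathsf{f}(x)=0,\quad \mathsf{f}(y)=d_0,$$ viewed as a representation of $U_q(\mathfrak{sl}_2)$ in the vector space $\mathbb{C}_q[x,y]$. Then it splits into the direct sum of subrepresentations $\mathbb{C}_q[x,y]=\bigoplus_{n=0}^\infty\mathcal{V}_n$, where $\mathcal{V}_n$ is a submodule generated by its lowest weight vector $x^n$. Each $\mathcal{V}_n$ with $n\ge 1$ is isomorphic to a simple lowest weight Verma module whose lowest weight is $q^n$. The submodule $\mathcal{V}_0$ admits a composition series of the form $0\subset\mathcal{J}_0\subset\mathcal{V}_0$, where $\mathcal{J}_0=\mathbb{C}\mathbf{1}$. The submodule $\mathcal{J}_0$ is not a direct summand in the category of $U_q(\mathfrak{sl}_2)$-modules (there exists no submodule $\mathcal{W}$ such that $\mathcal{V}_0=\mathcal{J}_0\oplus\mathcal{W}$). The quotient module $\mathcal{V}_0/\mathcal{J}_0$ is isomorphic to the (simple) lowest weight Verma module whose lowest weight is $q^2$.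
   Context: The quantum plane $\mathbb{C}_q[x,y]$ is the unital associative $\mathbb{C}$-algebra with generators $x,y$ and the single relation $yx=qxy$; the monomials $x^my^n$ ($m,n\ge 0$) form a basis. $U_q(\mathfrak{sl}_2)$ is the unital associative $\mathbb{C}$-algebra with generators $\mathsf{k},\mathsf{k}^{-1},\mathsf{e},\mathsf{f}$ and relations $\mathsf{k}^{-1}\mathsf{k}=\mathsf{k}\mathsf{k}^{-1}=\mathbf{1}$, $\mathsf{k}\mathsf{e}=q^2\mathsf{e}\mathsf{k}$, $\mathsf{k}\mathsf{f}=q^{-2}\mathsf{f}\mathsf{k}$, $\mathsf{e}\mathsf{f}-\mathsf{f}\mathsf{e}=\frac{\mathsf{k}-\mathsf{k}^{-1}}{q-q^{-1}}$, with comultiplication $\Delta(\mathsf{k})=\mathsf{k}\otimes\mathsf{k}$, $\Delta(\mathsf{e})=\mathbf{1}\otimes\mathsf{e}+\mathsf{e}\otimes\mathsf{k}$, $\Delta(\mathsf{f})=\mathsf{f}\otimes\mathbf{1}+\mathsf{k}^{-1}\otimes\mathsf{f}$ and counit $\varepsilon(\mathsf{k})=1$, $\varepsilon(\mathsf{e})=\varepsilon(\mathsf{f})=0$. A $U_q(\mathfrak{sl}_2)$-module algebra structure on $A=\mathbb{C}_q[x,y]$ is an algebra homomorphism $\pi:U_q(\mathfrak{sl}_2)\to\operatorname{End}_{\mathbb{C}}A$ such that $\pi(h)(ab)=\sum_i\pi(h_i')(a)\,\pi(h_i'')(b)$ (where $\Delta(h)=\sum_i h_i'\otimes h_i''$)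 and $\pi(h)(\mathbf{1})=\varepsilon(h)\mathbf{1}$ for all $h$ and all $a,b\in A$; one writes $h(a)$ for $\pi(h)(a)$. It is uniquely determined by the values of $\mathsf{k},\mathsf{e},\mathsf{f}$ on $x,y$; the values above do define such a structure. A lowest weight vector of weight $\mu$ is a nonzero vector $w$ with $\mathsf{f}w=0$ and $\mathsf{k}w=\mu w$. The lowest weight Verma module with lowest weight $\mu\in\mathbb{C}\setminus\{0\}$ is the universal module generated by a lowest weight vector of weight $\mu$, i.e. the quotient of $U_q(\mathfrak{sl}_2)$ by the left ideal generated by $\mathsf{f}$ and $\mathsf{k}-\mu\mathbf{1}$; it has basis $\{\mathsf{e}^iw_0\mid i\ge 0\}$, where $w_0$ is the image of $\mathbf{1}$.
   Formalization: Generation of V_n by x^n is stated only for n ≥ 1: as h(1)=ε(h)1, the submodule generated by x^0=1 is J_0 itself, so the claim fails for n=0; V_0 is asserted to exist as the remaining summand, with lowest weight vector 1 and all the other stated properties. *)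

theory Defs
  imports
    Complex_Main
    "HOL-Algebra.QuotRing"
    "HOL-Algebra.Module"
    "HOL-Library.Poly_Mapping"
    "HOL-Library.Product_Plus"
begin

section \<open>Free algebras and algebras given by generators and relations\<close>

text \<open>
  The monoid of words is written additively, so that the type of finitely supported
  functions on words, with the convolution product of \<^theory>\<open>HOL-Library.Poly_Mapping\<close>,
  is its monoid algebra, i.e. the free unital associative algebra.
\<close>

datatype 'g free_word = Word (letters: "'g list")

instantiation free_word :: (type) monoid_add
begin

definition zero_free_word :: "'a free_word" where
  "0 = Word []"

definition plus_free_word :: "'a free_word \<Rightarrow> 'a free_word \<Rightarrow> 'a free_word" where
  "u + v = Word (letters u @ letters v)"

instance
  by standard (simp_all add: zero_free_word_def plus_free_word_def)

end

type_synonym 'g free_alg = "'g free_word \<Rightarrow>\<^sub>0 complex"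

abbreviation scal :: "complex \<Rightarrow> 'm::zero \<Rightarrow>\<^sub>0 complex" where
  "scal c \<equiv> Poly_Mapping.single 0 c"

definition gen :: "'g \<Rightarrow> 'g free_alg" where
  "gen g = Poly_Mapping.single (Word [g]) 1"

text \<open>
  Complex algebras are represented by the record type \<^type>\<open>module_scheme\<close>, which extends the
  record type of rings by a scalar multiplication.
\<close>

definition free_algebra :: "(complex, 'g free_alg) module" where
  "free_algebra = \<lparr>carrier = UNIV, mult = (*), one = 1, zero = 0, add = (+),
     smult = (\<lambda>c p. scal c * p)\<rparr>"

definition presented_algebra :: "'g free_alg set \<Rightarrow> (complex, 'g free_alg set) module" where
  "presented_algebra R =
     (let I = Idl\<^bsub>free_algebra\<^esub> R in
      ring.extend (free_algebra Quot I)
        (module.fields (\<lambda>c X. \<Union>p\<in>X. I +>\<^bsub>free_algebra\<^esub> (c \<odot>\<^bsub>free_algebra\<^esub> p))))"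

definition presented_class :: "'g free_alg set \<Rightarrow> 'g free_alg \<Rightarrow> 'g free_alg set" where
  "presented_class R p = (Idl\<^bsub>free_algebra\<^esub> R) +>\<^bsub>free_algebra\<^esub> p"

text \<open>
  The extension of an assignment on generators to an algebra homomorphism on the free algebra;
  \<open>\<iota>\<close> is the structure map of the target algebra.
\<close>

definition free_extension ::
    "(complex \<Rightarrow> 'b::ring_1) \<Rightarrow> ('g \<Rightarrow> 'b) \<Rightarrow> 'g free_alg \<Rightarrow> 'b" where
  "free_extension \<iota> \<phi> p =
     (\<Sum>w\<in>Poly_Mapping.keys p. \<iota> (Poly_Mapping.lookup p w) * prod_list (map \<phi> (letters w)))"


section \<open>The quantum plane\<close>

datatype qplane_gen = GenX | GenY

definition qplane_rels :: "complex \<Rightarrow> qplane_gen free_alg set" where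
  "qplane_rels q = {gen GenY * gen GenX - scal q * gen GenX * gen GenY}"

definition qplane :: "complex \<Rightarrow> (complex, qplane_gen free_alg set) module" where
  "qplane q = presented_algebra (qplane_rels q)"

definition qplane_x :: "complex \<Rightarrow> qplane_gen free_alg set" where
  "qplane_x q = presented_class (qplane_rels q) (gen GenX)"

definition qplane_y :: "complex \<Rightarrow> qplane_gen free_alg set" where
  "qplane_y q = presented_class (qplane_rels q) (gen GenY)"


section \<open>The quantum enveloping algebra of sl(2)\<close>

datatype uq_gen = GenK | GenKinv | GenE | GenF

definition uq_rels :: "complex \<Rightarrow> uq_gen free_alg set" where
  "uq_rels q =
     {gen GenKinv * gen GenK - 1,
      gen GenK * gen GenKinv - 1,
      gen GenK * gen GenE - scal (q\<^sup>2) * gen GenE * gen GenK,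
      gen GenK * gen GenF - scal (inverse (q\<^sup>2)) * gen GenF * gen GenK,
      gen GenE * gen GenF - gen GenF * gen GenE
        - scal (1 / (q - inverse q)) * (gen GenK - gen GenKinv)}"

definition uq :: "complex \<Rightarrow> (complex, uq_gen free_alg set) module" where
  "uq q = presented_algebra (uq_rels q)"

definition uq_class :: "complex \<Rightarrow> uq_gen free_alg \<Rightarrow> uq_gen free_alg set" where
  "uq_class q = presented_class (uq_rels q)"

definition uq_k :: "complex \<Rightarrow> uq_gen free_alg set" where
  "uq_k q = uq_class q (gen GenK)"

definition uq_e :: "complex \<Rightarrow> uq_gen free_alg set" where
  "uq_e q = uq_class q (gen GenE)"

definition uq_f :: "complex \<Rightarrow> uq_gen free_alg set" where
  "uq_f q = uq_class q (gen GenF)"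

text \<open>
  Comultiplication and counit are given by their lifts to the free algebra on the generators.
  The tensor square of that free algebra is the monoid algebra of pairs of words, where the basis
  element \<open>(u, v)\<close> stands for the tensor product of \<open>u\<close> and \<open>v\<close>.
  The values on the inverse of k are forced by multiplicativity.
\<close>

fun uq_comult_gen :: "uq_gen \<Rightarrow> (uq_gen free_word \<times> uq_gen free_word) \<Rightarrow>\<^sub>0 complex" where
  "uq_comult_gen GenK = Poly_Mapping.single (Word [GenK], Word [GenK]) 1"
| "uq_comult_gen GenKinv = Poly_Mapping.single (Word [GenKinv], Word [GenKinv]) 1"
| "uq_comult_gen GenE =
     Poly_Mapping.single (Word [], Word [GenE]) 1 + Poly_Mapping.single (Word [GenE], Word [GenK]) 1"
| "uq_comult_gen GenF =
     Poly_Mapping.single (Word [GenF], Word []) 1 + Poly_Mapping.single (Word [GenKinv], Word [GenF]) 1"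

fun uq_counit_gen :: "uq_gen \<Rightarrow> complex" where
  "uq_counit_gen GenK = 1"
| "uq_counit_gen GenKinv = 1"
| "uq_counit_gen GenE = 0"
| "uq_counit_gen GenF = 0"

definition uq_comult :: "uq_gen free_alg \<Rightarrow> (uq_gen free_word \<times> uq_gen free_word) \<Rightarrow>\<^sub>0 complex" where
  "uq_comult = free_extension scal uq_comult_gen"

definition uq_counit :: "uq_gen free_alg \<Rightarrow> complex" where
  "uq_counit = free_extension (\<lambda>c. c) uq_counit_gen"


section \<open>Module algebra structures\<close>

definition linear_endo :: "(complex, 'a, 'm) module_scheme \<Rightarrow> ('a \<Rightarrow> 'a) \<Rightarrow> bool" where
  "linear_endo A T \<longleftrightarrow>
     T \<in> carrier A \<rightarrow> carrier A \<and>
     (\<forall>a\<in>carrier A. \<forall>b\<in>carrier A. T (a \<oplus>\<^bsub>A\<^esub> b) = T a \<oplus>\<^bsub>A\<^esub> T b) \<and>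
     (\<forall>c. \<forall>a\<in>carrier A. T (c \<odot>\<^bsub>A\<^esub> a) = c \<odot>\<^bsub>A\<^esub> T a)"

text \<open>
  Unital algebra homomorphisms from \<open>U\<close> to the algebra of linear endomorphisms of \<open>A\<close>, where
  endomorphisms are identified when they agree on the carrier.
\<close>

definition algebra_rep ::
    "(complex, 'u, 'k) module_scheme \<Rightarrow> (complex, 'a, 'm) module_scheme \<Rightarrow> ('u \<Rightarrow> 'a \<Rightarrow> 'a) \<Rightarrow> bool"
  where
  "algebra_rep U A \<pi> \<longleftrightarrow>
     (\<forall>h\<in>carrier U. linear_endo A (\<pi> h)) \<and>
     (\<forall>a\<in>carrier A.
        \<pi> \<one>\<^bsub>U\<^esub> a = a \<and>
        (\<forall>c. \<forall>h\<in>carrier U. \<pi> (c \<odot>\<^bsub>U\<^esub> h) a = c \<odot>\<^bsub>A\<^esub> \<pi> h a) \<and>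
        (\<forall>g\<in>carrier U. \<forall>h\<in>carrier U.
           \<pi> (g \<oplus>\<^bsub>U\<^esub> h) a = \<pi> g a \<oplus>\<^bsub>A\<^esub> \<pi> h a \<and>
           \<pi> (g \<otimes>\<^bsub>U\<^esub> h) a = \<pi> g (\<pi> h a)))"

text \<open>
  Every element of the quantum enveloping algebra is the class of some \<open>p\<close>. The keys of
  \<open>uq_comult p\<close> with their coefficients give a Sweedler decomposition of the coproduct of that
  class, once the two tensor factors are replaced by their classes.
\<close>

definition uq_module_algebra ::
    "complex \<Rightarrow> (complex, 'a, 'm) module_scheme \<Rightarrow> (uq_gen free_alg set \<Rightarrow> 'a \<Rightarrow> 'a) \<Rightarrow> bool"
  where
  "uq_module_algebra q A \<pi> \<longleftrightarrow>
     algebra_rep (uq q) A \<pi> \<and>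
     (\<forall>p. \<forall>a\<in>carrier A. \<forall>b\<in>carrier A.
        \<pi> (uq_class q p) (a \<otimes>\<^bsub>A\<^esub> b) =
          (\<Oplus>\<^bsub>A\<^esub>t\<in>Poly_Mapping.keys (uq_comult p).
             Poly_Mapping.lookup (uq_comult p) t \<odot>\<^bsub>A\<^esub>
               (\<pi> (uq_class q (Poly_Mapping.single (fst t) 1)) a \<otimes>\<^bsub>A\<^esub>
                \<pi> (uq_class q (Poly_Mapping.single (snd t) 1)) b))) \<and>
     (\<forall>p. \<pi> (uq_class q p) \<one>\<^bsub>A\<^esub> = uq_counit p \<odot>\<^bsub>A\<^esub> \<one>\<^bsub>A\<^esub>)"


section \<open>Left modules\<close>

text \<open>
  Left modules over a not necessarily commutative ring also use the record type
  \<^type>\<open>module_scheme\<close>; its multiplication and unit fields are then irrelevant.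
  The predicate \<^const>\<open>submodule\<close> of the library makes sense in this generality.
  For modules over a unital complex algebra, the complex vector space structure is the one
  obtained by restriction along the unit map, so that module homomorphisms and submodules are
  automatically complex linear.
\<close>

definition rep_module :: "(complex, 'a, 'm) module_scheme \<Rightarrow> ('u \<Rightarrow> 'a \<Rightarrow> 'a) \<Rightarrow> ('u, 'a) module"
  where
  "rep_module A \<pi> = ring.extend (ring.truncate A) (module.fields \<pi>)"

definition regular_module :: "('u, 'b) ring_scheme \<Rightarrow> ('u, 'u) module" where
  "regular_module U = ring.extend (ring.truncate U) (module.fields (\<lambda>g h. g \<otimes>\<^bsub>U\<^esub> h))"

definition quotient_module :: "('u, 'v, 'm) module_scheme \<Rightarrow> 'v set \<Rightarrow> ('u, 'v set) module" where
  "quotient_module M W =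
     \<lparr>carrier = a_rcosets\<^bsub>M\<^esub> W, mult = undefined, one = undefined, zero = W, add = set_add M,
      smult = (\<lambda>h X. \<Union>v\<in>X. W +>\<^bsub>M\<^esub> (h \<odot>\<^bsub>M\<^esub> v))\<rparr>"

definition generated_submodule ::
    "('u, 'b) ring_scheme \<Rightarrow> ('u, 'v, 'm) module_scheme \<Rightarrow> 'v set \<Rightarrow> 'v set" where
  "generated_submodule U M S = \<Inter>{W. submodule W U M \<and> S \<subseteq> W}"

definition module_isomorphic ::
    "('u, 'b) ring_scheme \<Rightarrow> ('u, 'v, 'm) module_scheme \<Rightarrow> ('u, 'w, 'n) module_scheme \<Rightarrow> bool" where
  "module_isomorphic U M N \<longleftrightarrow>
     (\<exists>\<phi>. bij_betw \<phi> (carrier M) (carrier N) \<and>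
        (\<forall>v\<in>carrier M. \<forall>w\<in>carrier M. \<phi> (v \<oplus>\<^bsub>M\<^esub> w) = \<phi> v \<oplus>\<^bsub>N\<^esub> \<phi> w) \<and>
        (\<forall>h\<in>carrier U. \<forall>v\<in>carrier M. \<phi> (h \<odot>\<^bsub>M\<^esub> v) = h \<odot>\<^bsub>N\<^esub> \<phi> v))"

definition simple_module :: "('u, 'b) ring_scheme \<Rightarrow> ('u, 'v, 'm) module_scheme \<Rightarrow> bool" where
  "simple_module U M \<longleftrightarrow>
     carrier M \<noteq> {\<zero>\<^bsub>M\<^esub>} \<and>
     (\<forall>W. submodule W U M \<longrightarrow> W = {\<zero>\<^bsub>M\<^esub>} \<or> W = carrier M)"

definition composition_series ::
    "('u, 'b) ring_scheme \<Rightarrow> ('u, 'v, 'm) module_scheme \<Rightarrow> 'v set list \<Rightarrow> bool" where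
  "composition_series U M Ns \<longleftrightarrow>
     Ns \<noteq> [] \<and> hd Ns = {\<zero>\<^bsub>M\<^esub>} \<and> last Ns = carrier M \<and>
     (\<forall>N\<in>set Ns. submodule N U M) \<and>
     (\<forall>i. Suc i < length Ns \<longrightarrow>
        Ns ! i \<subset> Ns ! Suc i \<and>
        simple_module U (quotient_module (M\<lparr>carrier := Ns ! Suc i\<rparr>) (Ns ! i)))"

definition internal_direct_sum ::
    "('u, 'b) ring_scheme \<Rightarrow> ('u, 'v, 'm) module_scheme \<Rightarrow> ('i \<Rightarrow> 'v set) \<Rightarrow> bool" where
  "internal_direct_sum U M V \<longleftrightarrow>
     (\<forall>i. submodule (V i) U M) \<and>
     (\<forall>m\<in>carrier M. \<exists>!v. (\<forall>i. v i \<in> V i) \<and> finite {i. v i \<noteq> \<zero>\<^bsub>M\<^esub>} \<and>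
        m = (\<Oplus>\<^bsub>M\<^esub>i\<in>{i. v i \<noteq> \<zero>\<^bsub>M\<^esub>}. v i))"

definition direct_summand ::
    "('u, 'b) ring_scheme \<Rightarrow> ('u, 'v, 'm) module_scheme \<Rightarrow> 'v set \<Rightarrow> bool" where
  "direct_summand U M J \<longleftrightarrow>
     (\<exists>W. submodule W U M \<and> J \<inter> W = {\<zero>\<^bsub>M\<^esub>} \<and> J <+>\<^bsub>M\<^esub> W = carrier M)"


section \<open>Lowest weight vectors and Verma modules\<close>

definition lowest_weight_vector ::
    "complex \<Rightarrow> (uq_gen free_alg set, 'v, 'm) module_scheme \<Rightarrow> complex \<Rightarrow> 'v \<Rightarrow> bool" where
  "lowest_weight_vector q M \<mu> w \<longleftrightarrow>
     w \<in> carrier M \<and> w \<noteq> \<zero>\<^bsub>M\<^esub> \<and>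
     uq_f q \<odot>\<^bsub>M\<^esub> w = \<zero>\<^bsub>M\<^esub> \<and>
     uq_k q \<odot>\<^bsub>M\<^esub> w = (\<mu> \<odot>\<^bsub>uq q\<^esub> \<one>\<^bsub>uq q\<^esub>) \<odot>\<^bsub>M\<^esub> w"

text \<open>Left ideals are the submodules of the regular module.\<close>

definition verma ::
    "complex \<Rightarrow> complex \<Rightarrow> (uq_gen free_alg set, uq_gen free_alg set set) module" where
  "verma q \<mu> =
     quotient_module (regular_module (uq q))
       (generated_submodule (uq q) (regular_module (uq q))
          {uq_f q, uq_k q \<ominus>\<^bsub>uq q\<^esub> (\<mu> \<odot>\<^bsub>uq q\<^esub> \<one>\<^bsub>uq q\<^esub>)})"

end

theory Submission
  imports Defs "HOL-Computational_Algebra.Polynomial"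
begin

text \<open>
  The operator \<open>f\<close> governs everything. It is a twisted derivation with \<open>f(x) = 0\<close> and \<open>f(y) = d0\<close>, so
  it kills the powers of \<open>x\<close> and sends \<open>x\<^sup>m y\<^bsup>j+1\<^esup>\<close> to a nonzero multiple of \<open>x\<^sup>m y\<^sup>j\<close>. Hence it is
  locally nilpotent and its kernel is spanned by the powers of \<open>x\<close>. Now take for each \<open>n\<close> any sequence
  starting at \<open>x\<^sup>n\<close> along which \<open>f\<close> moves one step down, up to nonzero factors (a \<^emph>\<open>ladder\<close>). For this
  reason alone the spans of these ladders form a direct sum, and the sum is the whole plane: a vector \<open>u\<close>
  is handled by induction on the power of \<open>f\<close> that kills it, correcting \<open>u\<close> by a preimage of \<open>f u\<close>
  inside the sum (\<open>directness\<close>, \<open>total_span_eq_carrier\<close>). The monomials themselves are such a family of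
  ladders; their linear independence is thereby reduced to that of the powers of \<open>x\<close>, which are
  separated by the homomorphism to \<open>\<complex>[x]\<close> that sends \<open>y\<close> to \<open>0\<close>.

  The ladders adapted to the module structure are \<open>x\<^sup>n, e x\<^sup>n, e\<^sup>2 x\<^sup>n, \<dots>\<close> for \<open>n \<ge> 1\<close>. The commutator
  relation gives \<open>f e\<^bsup>i+1\<^esup> x\<^sup>n = c\<^sub>i e\<^sup>i x\<^sup>n\<close>, where
  \<open>c\<^sub>i = - (q\<^bsup>i+1\<^esup> - q\<^bsup>-i-1\<^esup>) (q\<^bsup>n+i\<^esup> - q\<^bsup>-n-i\<^esup>) / (q - q\<inverse>)\<^sup>2\<close> is nonzero because \<open>q\<close> is not a root
  of unity. For \<open>n = 0\<close> this breaks down, since \<open>e(1) = 0\<close>. There the ladder is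
  \<open>1, y, e y, e\<^sup>2 y, \<dots>\<close>: its first step is \<open>f y = d0\<close>, and because \<open>e f y = 0\<close> the commutator computation
  also applies to \<open>y\<close>, which has weight \<open>q\<^sup>2\<close>. Each of these ladders spans a submodule.

  Let a module be generated by a lowest weight vector \<open>w\<close> such that all factors \<open>c\<^sub>i\<close> are nonzero. A
  power of \<open>f\<close> carries any nonzero vector to a nonzero multiple of \<open>w\<close>, so the module is simple. This
  applies to the Verma module too, which is nonzero because its defining left ideal annihilates \<open>w \<noteq> 0\<close>.
  By its simplicity that left ideal is the full annihilator of \<open>w\<close>, and so the given module is the
  Verma module (\<open>isomorphic_verma\<close>). The instances needed are the summands with \<open>n \<ge> 1\<close> and
  the quotient of the zeroth summand by the constants, generated by the class of \<open>y\<close>. Finally, the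
  constants have no complement \<open>W\<close>: writing \<open>y\<close> as a constant plus some \<open>w \<in> W\<close>, the constant
  \<open>d0 = f y = f w\<close> would lie in \<open>W\<close>.
\<close>

section \<open>Left modules over a ring\<close>

text \<open>
  Several of the modules below are built from the fields of another structure; only the additive
  fields matter here, whatever the types of the two records.
\<close>

lemma abelian_group_transfer:
  fixes A :: "('a, 'b) ring_scheme" and B :: "('a, 'c) ring_scheme"
  assumes "abelian_group A" "carrier B = carrier A" "zero B = zero A" "add B = add A"
  shows "abelian_group B"
proof -
  interpret A: abelian_group A by fact
  show ?thesis
    by (rule abelian_groupI) (auto simp: assms A.a_ac intro: bexI[of _ "\<ominus>\<^bsub>A\<^esub> _"] A.l_neg)
qed

text \<open>
  The scalars form an arbitrary ring, because enveloping algebras are not commutative.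
\<close>

locale left_module = U: ring U + abelian_group M
  for U :: "('u, 'b) ring_scheme" and M :: "('u, 'v, 'm) module_scheme" (structure) +
  assumes smult_closed [simp, intro]:
      "\<lbrakk>h \<in> carrier U; v \<in> carrier M\<rbrakk> \<Longrightarrow> h \<odot> v \<in> carrier M"
    and smult_l_distr:
      "\<lbrakk>g \<in> carrier U; h \<in> carrier U; v \<in> carrier M\<rbrakk> \<Longrightarrow> (g \<oplus>\<^bsub>U\<^esub> h) \<odot> v = g \<odot> v \<oplus> h \<odot> v"
    and smult_r_distr:
      "\<lbrakk>h \<in> carrier U; v \<in> carrier M; w \<in> carrier M\<rbrakk> \<Longrightarrow> h \<odot> (v \<oplus> w) = h \<odot> v \<oplus> h \<odot> w"
    and smult_assoc:
      "\<lbrakk>g \<in> carrier U; h \<in> carrier U; v \<in> carrier M\<rbrakk> \<Longrightarrow> (g \<otimes>\<^bsub>U\<^esub> h) \<odot> v = g \<odot> (h \<odot> v)"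
    and smult_one [simp]: "v \<in> carrier M \<Longrightarrow> \<one>\<^bsub>U\<^esub> \<odot> v = v"
begin

lemma smult_r_null [simp]: "h \<in> carrier U \<Longrightarrow> h \<odot> \<zero> = \<zero>"
  using smult_r_distr[of h \<zero> \<zero>] by (simp add: add.r_cancel_one')

lemma smult_l_null [simp]: "v \<in> carrier M \<Longrightarrow> \<zero>\<^bsub>U\<^esub> \<odot> v = \<zero>"
  using smult_l_distr[of "\<zero>\<^bsub>U\<^esub>" "\<zero>\<^bsub>U\<^esub>" v] by (simp add: add.r_cancel_one')

lemma minus_one_smult:
  assumes "v \<in> carrier M"
  shows "(\<ominus>\<^bsub>U\<^esub> \<one>\<^bsub>U\<^esub>) \<odot> v = \<ominus> v"
proof -
  have "(\<ominus>\<^bsub>U\<^esub> \<one>\<^bsub>U\<^esub>) \<odot> v \<oplus> v = ((\<ominus>\<^bsub>U\<^esub> \<one>\<^bsub>U\<^esub>) \<oplus>\<^bsub>U\<^esub> \<one>\<^bsub>U\<^esub>) \<odot> v"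
    using assms smult_l_distr[of "\<ominus>\<^bsub>U\<^esub> \<one>\<^bsub>U\<^esub>" "\<one>\<^bsub>U\<^esub>" v] by simp
  then show ?thesis
    using assms by (simp add: U.l_neg minus_equality)
qed

lemma submoduleI:
  assumes "W \<subseteq> carrier M" "\<zero> \<in> W" "\<And>v w. \<lbrakk>v \<in> W; w \<in> W\<rbrakk> \<Longrightarrow> v \<oplus> w \<in> W"
    and "\<And>h v. \<lbrakk>h \<in> carrier U; v \<in> W\<rbrakk> \<Longrightarrow> h \<odot> v \<in> W"
  shows "submodule W U M"
proof -
  have "\<ominus> v \<in> W" if "v \<in> W" for v
    using minus_one_smult[of v] assms(1) assms(4)[of "\<ominus>\<^bsub>U\<^esub> \<one>\<^bsub>U\<^esub>" v] that by auto
  then show ?thesis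
    using assms by unfold_locales (auto simp: a_inv_def)
qed

lemma submoduleD:
  assumes "submodule W U M"
  shows "W \<subseteq> carrier M" "\<zero> \<in> W" "\<And>v w. \<lbrakk>v \<in> W; w \<in> W\<rbrakk> \<Longrightarrow> v \<oplus> w \<in> W"
    and "\<And>h v. \<lbrakk>h \<in> carrier U; v \<in> W\<rbrakk> \<Longrightarrow> h \<odot> v \<in> W"
    and "\<And>v. v \<in> W \<Longrightarrow> \<ominus> v \<in> W"
proof -
  interpret W: submodule W U M by fact
  show sub: "W \<subseteq> carrier M" "\<zero> \<in> W" "\<And>v w. \<lbrakk>v \<in> W; w \<in> W\<rbrakk> \<Longrightarrow> v \<oplus> w \<in> W"
    and cl: "\<And>h v. \<lbrakk>h \<in> carrier U; v \<in> W\<rbrakk> \<Longrightarrow> h \<odot> v \<in> W"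
    using W.subset W.one_closed W.m_closed by auto
  show "\<And>v. v \<in> W \<Longrightarrow> \<ominus> v \<in> W"
    using sub cl minus_one_smult by (metis U.a_inv_closed U.one_closed subsetD)
qed

lemma submodule_additive: "submodule W U M \<Longrightarrow> subgroup W (add_monoid M)"
  by (simp add: submodule_def)

lemma restrict_left_module:
  assumes W: "submodule W U M"
  shows "left_module U (M\<lparr>carrier := W\<rparr>)"
proof -
  note D = submoduleD[OF W]
  have c: "v \<in> carrier M" if "v \<in> W" for v using D(1) that by blast
  have "abelian_group (M\<lparr>carrier := W\<rparr>)"
  proof (rule abelian_groupI)
    fix v assume "v \<in> carrier (M\<lparr>carrier := W\<rparr>)"
    then have "\<ominus> v \<in> W" "\<ominus> v \<oplus> v = \<zero>" using D c by (auto simp: l_neg)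
    then show "\<exists>y\<in>carrier (M\<lparr>carrier := W\<rparr>). y \<oplus>\<^bsub>M\<lparr>carrier := W\<rparr>\<^esub> v = \<zero>\<^bsub>M\<lparr>carrier := W\<rparr>\<^esub>"
      by auto
  qed (use D c in \<open>auto simp: a_ac\<close>)
  then show ?thesis
    using D c by (intro left_module.intro left_module_axioms.intro U.ring_axioms)
      (auto simp: smult_l_distr smult_r_distr smult_assoc)
qed

lemma submodule_restrict:
  assumes "submodule W U M" "submodule V U M" "W \<subseteq> V"
  shows "submodule W U (M\<lparr>carrier := V\<rparr>)"
  using submoduleD[OF assms(1)] assms(3)
  by (intro left_module.submoduleI[OF restrict_left_module[OF assms(2)]]) auto

lemma zero_submodule: "submodule {\<zero>} U M"
  by (rule submoduleI) auto

lemma quotient_class_eq_iff: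
  assumes W: "submodule W U M" and "v \<in> carrier M" "w \<in> carrier M"
  shows "W +> v = W +> w \<longleftrightarrow> v \<ominus> w \<in> W"
proof
  assume "W +> v = W +> w"
  then have "W +> (v \<ominus> w) = W"
    using a_coset_add_inv2[of W v w] assms submoduleD(1)[OF W] by (simp add: minus_eq)
  then show "v \<ominus> w \<in> W"
    using a_coset_join1 assms submodule_additive by auto
next
  assume "v \<ominus> w \<in> W"
  then have "W +> (v \<oplus> \<ominus> w) = W"
    using a_coset_join2[of "v \<ominus> w" W] assms submodule_additive by (simp add: minus_eq)
  then show "W +> v = W +> w"
    using a_coset_add_inv1 assms submoduleD(1)[OF W] by blast
qed

lemma quotient_class_zero:
  assumes "submodule W U M" "v \<in> carrier M"
  shows "W +> v = W \<longleftrightarrow> v \<in> W"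
  using a_coset_join1[of W v] a_coset_join2[of v W] assms submodule_additive by blast

lemma quotient_carrier: "carrier (quotient_module M W) = (\<lambda>v. W +> v) ` carrier M"
  by (auto simp: quotient_module_def A_RCOSETS_def')

lemma quotient_add:
  assumes W: "submodule W U M" and "v \<in> carrier M" "w \<in> carrier M"
  shows "(W +> v) \<oplus>\<^bsub>quotient_module M W\<^esub> (W +> w) = W +> (v \<oplus> w)"
proof -
  interpret abelian_subgroup W M
    using abelian_subgroupI2 a_comm_group submodule_additive[OF W] by blast
  show ?thesis using assms a_rcos_sum by (simp add: quotient_module_def)
qed

lemma quotient_zero: "\<zero>\<^bsub>quotient_module M W\<^esub> = W"
  by (simp add: quotient_module_def)

lemma quotient_smult:
  assumes W: "submodule W U M" and h: "h \<in> carrier U" and v: "v \<in> carrier M"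
  shows "h \<odot>\<^bsub>quotient_module M W\<^esub> (W +> v) = W +> (h \<odot> v)"
proof -
  have "W +> (h \<odot> u) = W +> (h \<odot> v)" if u: "u \<in> W +> v" for u
  proof -
    obtain s where s: "s \<in> W" "u = s \<oplus> v" using u by (auto simp: a_r_coset_def')
    have sM: "s \<in> carrier M" using s submoduleD(1)[OF W] by blast
    have "h \<odot> s \<in> W" using submoduleD(4)[OF W] h s by blast
    moreover have "h \<odot> u = h \<odot> s \<oplus> h \<odot> v" using s sM h v by (simp add: smult_r_distr)
    ultimately have "h \<odot> u \<ominus> h \<odot> v \<in> W" using h v sM
      by (simp add: minus_eq a_assoc r_neg)
    then show ?thesis using quotient_class_eq_iff[OF W] h v s sM by simp
  qed
  moreover have "v \<in> W +> v"
    using v submoduleD(2)[OF W] by (auto simp: a_r_coset_def' intro!: bexI[of _ \<zero>])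
  ultimately have "(\<Union>u\<in>W +> v. W +> (h \<odot> u)) = W +> (h \<odot> v)" by blast
  then show ?thesis by (simp add: quotient_module_def)
qed

lemma quotient_left_module:
  assumes W: "submodule W U M"
  shows "left_module U (quotient_module M W)"
proof -
  note S = quotient_add[OF W] quotient_smult[OF W] quotient_carrier quotient_zero
  have z: "W = W +> \<zero>" using quotient_class_zero[OF W, of \<zero>] submoduleD(2)[OF W] by simp
  have "abelian_group (quotient_module M W)"
  proof (rule abelian_groupI)
    show "\<zero>\<^bsub>quotient_module M W\<^esub> \<in> carrier (quotient_module M W)"
      using z by (auto simp: S)
    fix x assume x: "x \<in> carrier (quotient_module M W)"
    then obtain v where v: "v \<in> carrier M" "x = W +> v" by (auto simp: S)
    show "\<zero>\<^bsub>quotient_module M W\<^esub> \<oplus>\<^bsub>quotient_module M W\<^esub> x = x"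
      using v quotient_add[OF W, of \<zero> v] z by (simp add: quotient_zero)
    show "\<exists>y\<in>carrier (quotient_module M W). y \<oplus>\<^bsub>quotient_module M W\<^esub> x = \<zero>\<^bsub>quotient_module M W\<^esub>"
    proof (rule bexI)
      show "(W +> \<ominus> v) \<oplus>\<^bsub>quotient_module M W\<^esub> x = \<zero>\<^bsub>quotient_module M W\<^esub>"
        using v z by (simp add: S l_neg)
    qed (use v in \<open>auto simp: S\<close>)
  qed (auto simp: S a_ac)
  then show ?thesis
    by (intro left_module.intro left_module_axioms.intro U.ring_axioms)
      (auto simp: S smult_l_distr smult_r_distr smult_assoc)
qed

text \<open>
  Simplicity is always obtained from transitivity: any vector is reached from any nonzero one.
\<close>

lemma simple_moduleI:
  assumes "w \<in> carrier M" "w \<noteq> \<zero>"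
    and "\<And>u v. \<lbrakk>u \<in> carrier M; v \<in> carrier M; v \<noteq> \<zero>\<rbrakk> \<Longrightarrow> \<exists>h\<in>carrier U. u = h \<odot> v"
  shows "simple_module U M"
  unfolding simple_module_def
proof (intro conjI allI impI)
  show "carrier M \<noteq> {\<zero>}" using assms by blast
  fix W assume W: "submodule W U M"
  note D = submoduleD[OF W]
  show "W = {\<zero>} \<or> W = carrier M"
  proof (cases "W = {\<zero>}")
    case False
    then obtain v where "v \<in> W" "v \<noteq> \<zero>" using D(2) by blast
    then have "u \<in> W" if "u \<in> carrier M" for u
      using assms(3)[of u v] D that by blast
    then show ?thesis using D by blast
  qed simp
qed

lemma generated_submodule_submodule:
  assumes "S \<subseteq> carrier M"
  shows "submodule (generated_submodule U M S) U M"
proof -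
  have top: "submodule (carrier M) U M" by (rule submoduleI) auto
  show ?thesis
  proof (rule submoduleI)
    show "generated_submodule U M S \<subseteq> carrier M"
      using top assms by (auto simp: generated_submodule_def)
  qed (auto simp: generated_submodule_def dest: submoduleD)
qed

end

lemma generated_submodule_superset: "S \<subseteq> generated_submodule U M S"
  by (auto simp: generated_submodule_def)

lemma generated_submodule_least:
  "\<lbrakk>submodule W U M; S \<subseteq> W\<rbrakk> \<Longrightarrow> generated_submodule U M S \<subseteq> W"
  by (auto simp: generated_submodule_def)

lemma regular_left_module:
  assumes "ring U"
  shows "left_module U (regular_module U)"
proof -
  interpret ring U by fact
  have "abelian_group (regular_module U)"
    by (rule abelian_group_transfer[OF abelian_group_axioms])
      (simp_all add: regular_module_def ring.defs)
  then show ?thesis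
    by (intro left_module.intro left_module_axioms.intro ring_axioms)
      (simp_all add: regular_module_def ring.defs module.defs l_distr r_distr m_assoc)
qed

lemma regular_module_simps:
  "carrier (regular_module U) = carrier U" "\<zero>\<^bsub>regular_module U\<^esub> = \<zero>\<^bsub>U\<^esub>"
  "g \<oplus>\<^bsub>regular_module U\<^esub> h = g \<oplus>\<^bsub>U\<^esub> h" "g \<odot>\<^bsub>regular_module U\<^esub> h = g \<otimes>\<^bsub>U\<^esub> h"
  by (simp_all add: regular_module_def ring.defs module.defs)

section \<open>Free algebras and presented algebras\<close>

lemma poly_mapping_expand:
  fixes p :: "'a \<Rightarrow>\<^sub>0 'b::comm_monoid_add"
  shows "p = (\<Sum>w\<in>Poly_Mapping.keys p. Poly_Mapping.single w (Poly_Mapping.lookup p w))"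
proof (rule poly_mapping_eqI)
  fix u
  show "Poly_Mapping.lookup p u =
    Poly_Mapping.lookup (\<Sum>w\<in>Poly_Mapping.keys p. Poly_Mapping.single w (Poly_Mapping.lookup p w)) u"
    by (simp add: lookup_sum lookup_single when_def sum.If_cases Int_def in_keys_iff)
qed

lemma single_Word_Cons:
  "Poly_Mapping.single (Word (g # ws)) (1::complex) = gen g * Poly_Mapping.single (Word ws) 1"
  by (simp add: gen_def mult_single plus_free_word_def)

text \<open>
  The shape of induction used for statements about all elements of a presented algebra: words are
  built by left multiplication with generators, so a claim need only be stable under the action of
  scalars and of single generators.
\<close>

lemma free_alg_induct [case_names zero one add scal gen]:
  fixes p :: "'g free_alg"
  assumes "P 0" "P 1" and add: "\<And>p p'. \<lbrakk>P p; P p'\<rbrakk> \<Longrightarrow> P (p + p')"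
    and scal: "\<And>c p. P p \<Longrightarrow> P (scal c * p)" and gen: "\<And>g p. P p \<Longrightarrow> P (gen g * p)"
  shows "P p"
proof -
  have word: "P (Poly_Mapping.single (Word ws) 1)" for ws
  proof (induction ws)
    case Nil
    have "Poly_Mapping.single (Word []) (1::complex) = 1"
      by (metis single_one zero_free_word_def)
    then show ?case using assms(2) by metis
  next
    case (Cons g ws)
    then show ?case using gen single_Word_Cons by metis
  qed
  have single: "P (Poly_Mapping.single w c)" for w c
    using scal[OF word[of "letters w"], of c] by (simp add: mult_single)
  have "P (\<Sum>w\<in>S. Poly_Mapping.single w (f w))" if "finite S" for S f
    using that by induction (auto intro: assms(1) add single)
  then show ?thesis using poly_mapping_expand[of p] by (metis finite_keys)
qed

lemma scal_central: "p * scal c = scal c * (p :: 'g free_alg)"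
proof (induction p rule: free_alg_induct)
  case (scal d p)
  have *: "scal d * scal c = scal c * (scal d :: 'g free_alg)" by (simp add: mult_single mult.commute)
  have "scal d * p * scal c = scal d * scal c * p" using scal by (simp only: mult.assoc)
  also have "\<dots> = scal c * (scal d * p)" using * by (simp only: mult.assoc[symmetric])
  finally show ?case .
next
  case (gen g p)
  have *: "gen g * scal c = scal c * gen g" by (simp add: gen_def mult_single)
  have "gen g * p * scal c = gen g * scal c * p" using gen by (simp only: mult.assoc)
  also have "\<dots> = scal c * (gen g * p)" using * by (simp only: mult.assoc[symmetric])
  finally show ?case .
qed (simp_all add: distrib_left distrib_right)

interpretation free_algebra: ring "free_algebra :: (complex, 'g free_alg) module"
proof (rule ringI)
  show "abelian_group (free_algebra :: (complex, 'g free_alg) module)"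
  proof (rule abelian_groupI)
    fix x :: "'g free_alg"
    show "\<exists>y\<in>carrier free_algebra. y \<oplus>\<^bsub>free_algebra\<^esub> x = \<zero>\<^bsub>free_algebra\<^esub>"
      by (intro bexI[of _ "- x"]) (auto simp: free_algebra_def)
  qed (auto simp: free_algebra_def add_ac)
  show "Group.monoid (free_algebra :: (complex, 'g free_alg) module)"
    by (rule monoidI) (auto simp: free_algebra_def mult.assoc)
qed (auto simp: free_algebra_def distrib_left distrib_right)

lemma free_algebra_simps [simp]:
  "carrier free_algebra = UNIV" "p \<otimes>\<^bsub>free_algebra\<^esub> p' = p * p'" "\<one>\<^bsub>free_algebra\<^esub> = 1"
  "\<zero>\<^bsub>free_algebra\<^esub> = 0" "p \<oplus>\<^bsub>free_algebra\<^esub> p' = p + p'" "c \<odot>\<^bsub>free_algebra\<^esub> p = scal c * p"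
  by (simp_all add: free_algebra_def)

lemma free_algebra_a_inv [simp]: "a_inv free_algebra p = - p"
  using free_algebra.minus_equality[of "- p" p] by simp

lemma free_algebra_minus [simp]: "a_minus free_algebra p p' = p - p'"
  by (simp add: a_minus_def)

text \<open>
  Moves computations with cosets to their representatives, which live in a type class ring.
\<close>

lemma presented_class_eq_iff:
  "presented_class R p = presented_class R p' \<longleftrightarrow> p - p' \<in> Idl\<^bsub>free_algebra\<^esub> R"
  using free_algebra.quotient_eq_iff_same_a_r_cos[OF free_algebra.genideal_ideal, of R p p']
  by (simp add: presented_class_def)

lemma presented_class_eqI:
  assumes "p - p' \<in> R"
  shows "presented_class R p = presented_class R p'"
  using assms free_algebra.genideal_self[of R] by (auto simp: presented_class_eq_iff simp del: set_eq_iff)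

lemma presented_carrier: "carrier (presented_algebra R) = range (presented_class R)"
  by (auto simp: presented_algebra_def Let_def ring.defs FactRing_def A_RCOSETS_def' presented_class_def)

lemma presented_class_in_carrier [simp, intro]:
  "presented_class R p \<in> carrier (presented_algebra R)"
  by (simp add: presented_carrier)

lemma presented_add [simp]:
  "presented_class R p \<oplus>\<^bsub>presented_algebra R\<^esub> presented_class R p' = presented_class R (p + p')"
proof -
  interpret ideal "Idl\<^bsub>free_algebra\<^esub> R" free_algebra by (rule free_algebra.genideal_ideal) simp
  show ?thesis
    using a_rcos_sum[of p p']
    by (simp add: presented_algebra_def Let_def ring.defs FactRing_def presented_class_def)
qed

lemma presented_mult [simp]:
  "presented_class R p \<otimes>\<^bsub>presented_algebra R\<^esub> presented_class R p' = presented_class R (p * p')"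
proof -
  interpret ideal "Idl\<^bsub>free_algebra\<^esub> R" free_algebra by (rule free_algebra.genideal_ideal) simp
  show ?thesis
    using rcoset_mult_add[of p p']
    by (simp add: presented_algebra_def Let_def ring.defs FactRing_def presented_class_def)
qed

lemma presented_one: "\<one>\<^bsub>presented_algebra R\<^esub> = presented_class R 1"
  by (simp add: presented_algebra_def Let_def ring.defs FactRing_def presented_class_def)

lemma presented_zero: "\<zero>\<^bsub>presented_algebra R\<^esub> = presented_class R 0"
proof -
  interpret ideal "Idl\<^bsub>free_algebra\<^esub> R" free_algebra by (rule free_algebra.genideal_ideal) simp
  show ?thesis
    using free_algebra.a_coset_add_zero[OF a_subset]
    by (simp add: presented_algebra_def Let_def ring.defs FactRing_def presented_class_def)
qed

lemma presented_smult [simp]: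
  "c \<odot>\<^bsub>presented_algebra R\<^esub> presented_class R p = presented_class R (scal c * p)"
proof -
  interpret ideal "Idl\<^bsub>free_algebra\<^esub> R" free_algebra by (rule free_algebra.genideal_ideal) simp
  have "presented_class R (scal c * p') = presented_class R (scal c * p)"
    if "p' \<in> presented_class R p" for p'
  proof -
    obtain s where "s \<in> Idl\<^bsub>free_algebra\<^esub> R" "p' = s + p"
      using \<open>p' \<in> presented_class R p\<close> by (auto simp: presented_class_def a_r_coset_def')
    moreover have "scal c * s \<in> Idl\<^bsub>free_algebra\<^esub> R" using calculation I_l_closed[of s "scal c"] by simp
    ultimately show ?thesis by (simp add: presented_class_eq_iff distrib_left)
  qed
  moreover have "p \<in> presented_class R p"
    using a_rcos_self[of p] by (simp add: presented_class_def)
  ultimately have "(\<Union>p'\<in>presented_class R p. presented_class R (scal c * p')) = presented_class R (scal c * p)"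
    by blast
  then show ?thesis
    by (simp add: presented_algebra_def Let_def ring.defs module.defs presented_class_def)
qed

lemma ring_presented_algebra: "ring (presented_algebra R)"
proof (rule ringI)
  note S = presented_carrier presented_one presented_zero
  show "abelian_group (presented_algebra R)"
  proof (rule abelian_groupI)
    fix X assume "X \<in> carrier (presented_algebra R)"
    then obtain p where "X = presented_class R p" by (auto simp: S)
    then show "\<exists>Y\<in>carrier (presented_algebra R). Y \<oplus>\<^bsub>presented_algebra R\<^esub> X = \<zero>\<^bsub>presented_algebra R\<^esub>"
      by (intro bexI[of _ "presented_class R (- p)"]) (auto simp: S)
  qed (auto simp: S add_ac)
  show "Group.monoid (presented_algebra R)"
    by (rule monoidI) (auto simp: S mult.assoc)
qed (auto simp: presented_carrier distrib_left distrib_right)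

lemma presented_pow [simp]:
  "presented_class R p [^]\<^bsub>presented_algebra R\<^esub> (n::nat) = presented_class R (p ^ n)"
proof -
  interpret ring "presented_algebra R" by (rule ring_presented_algebra)
  show ?thesis by (induction n) (simp_all add: presented_one power_commutes)
qed

subsection \<open>Homomorphisms from free algebras\<close>

lemma free_extension_superset:
  assumes "\<iota> 0 = 0" "finite S" "Poly_Mapping.keys p \<subseteq> S"
  shows "free_extension \<iota> \<phi> p = (\<Sum>w\<in>S. \<iota> (Poly_Mapping.lookup p w) * prod_list (map \<phi> (letters w)))"
  unfolding free_extension_def
  using assms by (intro sum.mono_neutral_left) (auto simp: in_keys_iff)

lemma free_extension_gen: "\<iota> 1 = 1 \<Longrightarrow> free_extension \<iota> \<phi> (gen g) = \<phi> g"
  by (simp add: free_extension_def gen_def)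

text \<open>
  Commutativity of the target is what makes the extension multiplicative for an arbitrary choice of
  images of the generators.
\<close>

locale scalar_embedding =
  fixes \<iota> :: "complex \<Rightarrow> 'b::comm_ring_1"
  assumes add: "\<iota> (c + d) = \<iota> c + \<iota> d" and mult: "\<iota> (c * d) = \<iota> c * \<iota> d" and one: "\<iota> 1 = 1"
begin

lemma zero: "\<iota> 0 = 0"
  using add[of 0 0] by simp

lemma free_extension_add:
  "free_extension \<iota> \<phi> (p + p') = free_extension \<iota> \<phi> p + free_extension \<iota> \<phi> p'"
proof -
  define S where "S = Poly_Mapping.keys p \<union> Poly_Mapping.keys p'"
  have *: "finite S" "Poly_Mapping.keys p \<subseteq> S" "Poly_Mapping.keys p' \<subseteq> S" "Poly_Mapping.keys (p + p') \<subseteq> S"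
    using keys_add[of p p'] by (auto simp: S_def)
  show ?thesis
    by (simp add: free_extension_superset[where \<iota> = \<iota>, OF zero *(1)] * lookup_add add distrib_right sum.distrib)
qed

lemma free_extension_single:
  "free_extension \<iota> \<phi> (Poly_Mapping.single w c) = \<iota> c * prod_list (map \<phi> (letters w))"
  by (subst free_extension_superset[where \<iota> = \<iota> and S = "{w}", OF zero]) auto

lemma free_extension_zero: "free_extension \<iota> \<phi> 0 = 0"
  by (simp add: free_extension_def)

lemma free_extension_sum:
  "free_extension \<iota> \<phi> (\<Sum>i\<in>S. f i) = (\<Sum>i\<in>S. free_extension \<iota> \<phi> (f i))"
  by (induction S rule: infinite_finite_induct) (auto simp: free_extension_zero free_extension_add)

lemma free_extension_mult:
  "free_extension \<iota> \<phi> (p * p') = free_extension \<iota> \<phi> p * free_extension \<iota> \<phi> p'"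
proof -
  have single: "free_extension \<iota> \<phi> (Poly_Mapping.single u c * Poly_Mapping.single v d) =
      free_extension \<iota> \<phi> (Poly_Mapping.single u c) * free_extension \<iota> \<phi> (Poly_Mapping.single v d)" for u v c d
    by (simp add: mult_single free_extension_single mult plus_free_word_def mult_ac)
  have "free_extension \<iota> \<phi> ((\<Sum>u\<in>S. Poly_Mapping.single u (f u)) * (\<Sum>v\<in>T. Poly_Mapping.single v (g v))) =
      free_extension \<iota> \<phi> (\<Sum>u\<in>S. Poly_Mapping.single u (f u)) *
      free_extension \<iota> \<phi> (\<Sum>v\<in>T. Poly_Mapping.single v (g v))" for S T f g
    by (simp only: sum_product free_extension_sum single)
  from this[of "Poly_Mapping.lookup p" "Poly_Mapping.keys p" "Poly_Mapping.lookup p'" "Poly_Mapping.keys p'"]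
  show ?thesis by (simp only: poly_mapping_expand[symmetric])
qed

lemma free_extension_genideal:
  assumes "\<And>r. r \<in> R \<Longrightarrow> free_extension \<iota> \<phi> r = 0" "p \<in> Idl\<^bsub>free_algebra\<^esub> R"
  shows "free_extension \<iota> \<phi> p = 0"
proof -
  have neg: "free_extension \<iota> \<phi> (- p) = 0" if "free_extension \<iota> \<phi> p = 0" for p
    using free_extension_add[of \<phi> p "- p"] that by (simp add: free_extension_zero)
  have "ideal {p. free_extension \<iota> \<phi> p = 0} free_algebra"
  proof (rule idealI[OF free_algebra.ring_axioms])
    show "subgroup {p. free_extension \<iota> \<phi> p = 0} (add_monoid free_algebra)"
      by (rule free_algebra.add.subgroupI)
        (auto simp: free_extension_add neg intro: exI[of _ 0] free_extension_zero)
  qed (auto simp: free_extension_mult)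
  then have "Idl\<^bsub>free_algebra\<^esub> R \<subseteq> {p. free_extension \<iota> \<phi> p = 0}"
    using assms(1) by (intro free_algebra.genideal_minimal) auto
  then show ?thesis using assms(2) by blast
qed

lemma free_extension_presented_class:
  assumes "\<And>r. r \<in> R \<Longrightarrow> free_extension \<iota> \<phi> r = 0" "presented_class R p = presented_class R p'"
  shows "free_extension \<iota> \<phi> p = free_extension \<iota> \<phi> p'"
proof -
  have "free_extension \<iota> \<phi> (p - p') = 0"
    using assms(1) by (rule free_extension_genideal[of R]) (use assms(2) in \<open>simp_all add: presented_class_eq_iff\<close>)
  then show ?thesis using free_extension_add[of \<phi> "p - p'" p'] by simp
qed

end

section \<open>Modules over the quantum enveloping algebra\<close>

lemma uq_carrier: "carrier (uq q) = range (uq_class q)"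
  by (simp add: uq_def uq_class_def presented_carrier)

lemma uq_class_in_carrier [simp, intro]: "uq_class q p \<in> carrier (uq q)"
  by (simp add: uq_carrier)

lemma uq_class_add: "uq_class q p \<oplus>\<^bsub>uq q\<^esub> uq_class q p' = uq_class q (p + p')"
  and uq_class_mult: "uq_class q p \<otimes>\<^bsub>uq q\<^esub> uq_class q p' = uq_class q (p * p')"
  and uq_class_smult: "c \<odot>\<^bsub>uq q\<^esub> uq_class q p = uq_class q (scal c * p)"
  and uq_class_one: "\<one>\<^bsub>uq q\<^esub> = uq_class q 1"
  and uq_class_zero: "\<zero>\<^bsub>uq q\<^esub> = uq_class q 0"
  by (simp_all add: uq_def uq_class_def presented_one presented_zero)

lemma uq_class_eqI: "p - p' \<in> uq_rels q \<Longrightarrow> uq_class q p = uq_class q p'"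
  by (simp add: uq_class_def presented_class_eqI)

lemma ring_uq: "ring (uq q)"
  by (simp add: uq_def ring_presented_algebra)

text \<open>
  The action of representatives \<open>p\<close> in the free algebra is easier to compute with than that of
  classes: it turns module identities into identities of a type class ring. The underlying complex
  vector space structure is the action of the scalars \<open>scal c\<close>.
\<close>

locale uq_module = left_module "uq q" M
  for q :: complex and M :: "(uq_gen free_alg set, 'v, 'm) module_scheme" (structure)
begin

definition act :: "uq_gen free_alg \<Rightarrow> 'v \<Rightarrow> 'v" where
  "act p v = uq_class q p \<odot> v"

abbreviation scale :: "complex \<Rightarrow> 'v \<Rightarrow> 'v" (infixr "\<cdot>" 75) where
  "c \<cdot> v \<equiv> act (scal c) v"

abbreviation "K \<equiv> act (gen GenK)"
abbreviation "Kinv \<equiv> act (gen GenKinv)"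
abbreviation "E \<equiv> act (gen GenE)"
abbreviation "F \<equiv> act (gen GenF)"

lemma act_closed [simp, intro]: "v \<in> carrier M \<Longrightarrow> act p v \<in> carrier M"
  by (simp add: act_def)

lemma act_add [simp]:
  "\<lbrakk>v \<in> carrier M; w \<in> carrier M\<rbrakk> \<Longrightarrow> act p (v \<oplus> w) = act p v \<oplus> act p w"
  by (simp add: act_def smult_r_distr)

lemma act_plus: "v \<in> carrier M \<Longrightarrow> act (p + p') v = act p v \<oplus> act p' v"
  by (simp add: act_def smult_l_distr[symmetric] uq_class_add)

lemma act_mult: "v \<in> carrier M \<Longrightarrow> act (p * p') v = act p (act p' v)"
  by (simp add: act_def smult_assoc[symmetric] uq_class_mult)

lemma act_one [simp]: "v \<in> carrier M \<Longrightarrow> act 1 v = v"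
  by (simp add: act_def uq_class_one[symmetric])

lemma act_zero_left [simp]: "v \<in> carrier M \<Longrightarrow> act 0 v = \<zero>"
  by (simp add: act_def uq_class_zero[symmetric])

lemma act_zero_right [simp]: "act p \<zero> = \<zero>"
  by (simp add: act_def)

lemma act_cong: "p - p' \<in> uq_rels q \<Longrightarrow> act p v = act p' v"
  by (simp add: act_def uq_class_eqI[of p p'])

lemma scale_add_left: "v \<in> carrier M \<Longrightarrow> (c + d) \<cdot> v = c \<cdot> v \<oplus> d \<cdot> v"
  by (simp add: single_add act_plus)

lemma scale_scale [simp]: "v \<in> carrier M \<Longrightarrow> c \<cdot> d \<cdot> v = (c * d) \<cdot> v"
  by (simp add: act_mult[symmetric] mult_single)

lemma scale_one: "v \<in> carrier M \<Longrightarrow> 1 \<cdot> v = v"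
  by simp

lemma act_scale: "v \<in> carrier M \<Longrightarrow> act p (c \<cdot> v) = c \<cdot> act p v"
  by (simp add: act_mult[symmetric] scal_central)

text \<open>
  Only the instances for generators may rewrite: for scalars the general rule would swap two
  scalings back and forth.
\<close>

lemmas act_gen_scale [simp] = act_scale[where p = "gen g" for g]

lemma minus_eq_scale: "v \<in> carrier M \<Longrightarrow> \<ominus> v = (-1) \<cdot> v"
  using scale_add_left[of v "-1" 1] by (simp add: minus_equality)

lemma act_minus: "v \<in> carrier M \<Longrightarrow> act p (\<ominus> v) = \<ominus> act p v"
  by (simp only: minus_eq_scale act_closed act_scale)

lemma act_funpow_closed [simp, intro]: "v \<in> carrier M \<Longrightarrow> (act p ^^ n) v \<in> carrier M"
  by (induction n) auto

lemma act_power: "v \<in> carrier M \<Longrightarrow> act (p ^ n) v = (act p ^^ n) v"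
  by (induction n) (simp_all add: act_mult)

lemma act_funpow_zero [simp]: "(act p ^^ n) \<zero> = \<zero>"
  by (induction n) auto

lemma act_funpow_add [simp]:
  "\<lbrakk>v \<in> carrier M; w \<in> carrier M\<rbrakk> \<Longrightarrow> (act p ^^ n) (v \<oplus> w) = (act p ^^ n) v \<oplus> (act p ^^ n) w"
  by (simp add: act_power[symmetric])

lemma act_funpow_scale [simp]: "v \<in> carrier M \<Longrightarrow> (act p ^^ n) (c \<cdot> v) = c \<cdot> (act p ^^ n) v"
  by (simp add: act_power[symmetric] act_scale)

lemma scale_eq_zero_iff: "v \<in> carrier M \<Longrightarrow> c \<cdot> v = \<zero> \<longleftrightarrow> c = 0 \<or> v = \<zero>"
proof
  assume v: "v \<in> carrier M" and "c \<cdot> v = \<zero>"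
  show "c = 0 \<or> v = \<zero>"
  proof (cases "c = 0")
    case False
    then have "v = inverse c \<cdot> c \<cdot> v" using v by simp
    then show ?thesis using \<open>c \<cdot> v = \<zero>\<close> by simp
  qed simp
qed auto

lemma Kinv_K: "v \<in> carrier M \<Longrightarrow> Kinv (K v) = v"
  using act_cong[of "gen GenKinv * gen GenK" 1 v] by (simp add: uq_rels_def act_mult)

lemma K_E: "v \<in> carrier M \<Longrightarrow> K (E v) = q\<^sup>2 \<cdot> E (K v)"
  using act_cong[of "gen GenK * gen GenE" "scal (q\<^sup>2) * gen GenE * gen GenK" v]
  by (simp add: uq_rels_def act_mult)

lemma E_F:
  assumes v: "v \<in> carrier M"
  shows "E (F v) = F (E v) \<oplus> (1 / (q - inverse q)) \<cdot> (K v \<oplus> (-1) \<cdot> Kinv v)"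
proof -
  have minus: "gen GenK - gen GenKinv = gen GenK + scal (-1) * (gen GenKinv :: uq_gen free_alg)"
    using single_uminus[of "0::uq_gen free_word" "1::complex"] by simp
  then have "act (gen GenE * gen GenF) v =
      act (gen GenF * gen GenE + scal (1 / (q - inverse q)) * (gen GenK + scal (-1) * gen GenKinv)) v"
    by (intro act_cong) (simp only: uq_rels_def minus[symmetric] diff_diff_eq[symmetric] insert_iff simp_thms)
  then show ?thesis using v by (simp only: act_mult act_plus act_closed)
qed

lemma Kinv_eigen:
  assumes v: "v \<in> carrier M" and K: "K v = c \<cdot> v" and "c \<noteq> 0"
  shows "Kinv v = inverse c \<cdot> v"
proof -
  have "inverse c \<cdot> v = inverse c \<cdot> Kinv (c \<cdot> v)" using Kinv_K[OF v] K by simp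
  also have "\<dots> = Kinv v" using assms by simp
  finally show ?thesis by simp
qed

text \<open>
  The generators suffice because every element of the algebra is a sum of scaled words in them.
\<close>

lemma submodule_generatorsI:
  assumes W: "W \<subseteq> carrier M" "\<zero> \<in> W" "\<And>v w. \<lbrakk>v \<in> W; w \<in> W\<rbrakk> \<Longrightarrow> v \<oplus> w \<in> W"
    and scale: "\<And>c v. v \<in> W \<Longrightarrow> c \<cdot> v \<in> W" and gen: "\<And>g v. v \<in> W \<Longrightarrow> act (gen g) v \<in> W"
  shows "submodule W (uq q) M"
proof (rule submoduleI)
  have "\<forall>v\<in>W. act p v \<in> W" for p
  proof (induction p rule: free_alg_induct)
    case (add p p')
    then show ?case using W by (auto simp: act_plus subset_iff)
  next
    case (scal c p)
    then show ?case using W(1) scale by (auto simp: act_mult subset_iff)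
  next
    case (gen g p)
    then show ?case using W(1) assms(5) by (auto simp: act_mult subset_iff)
  qed (use W in \<open>auto simp: subset_iff\<close>)
  then show "h \<odot> v \<in> W" if "h \<in> carrier (uq q)" "v \<in> W" for h v
    using that by (auto simp: uq_carrier act_def)
qed (use W in auto)

lemma submodule_act: "\<lbrakk>submodule W (uq q) M; v \<in> W\<rbrakk> \<Longrightarrow> act p v \<in> W"
  by (simp add: act_def submoduleD)

lemma restrict_uq_module: "submodule W (uq q) M \<Longrightarrow> uq_module q (M\<lparr>carrier := W\<rparr>)"
  by (simp add: uq_module_def restrict_left_module)

lemma quotient_uq_module: "submodule W (uq q) M \<Longrightarrow> uq_module q (quotient_module M W)"
  by (simp add: uq_module_def quotient_left_module)

lemma restrict_act: "submodule W (uq q) M \<Longrightarrow> uq_module.act q (M\<lparr>carrier := W\<rparr>) p v = act p v"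
  by (simp add: act_def uq_module.act_def[OF restrict_uq_module])

lemma quotient_act:
  assumes "submodule W (uq q) M" "v \<in> carrier M"
  shows "uq_module.act q (quotient_module M W) p (W +> v) = W +> act p v"
  using assms by (simp add: act_def uq_module.act_def[OF quotient_uq_module] quotient_smult)

lemma cyclic_submodule:
  assumes "v \<in> carrier M"
  shows "submodule (range (\<lambda>p. act p v)) (uq q) M"
proof (rule submodule_generatorsI)
  show "\<zero> \<in> range (\<lambda>p. act p v)" using assms act_zero_left by (metis rangeI)
  show "x \<oplus> y \<in> range (\<lambda>p. act p v)"
    if "x \<in> range (\<lambda>p. act p v)" "y \<in> range (\<lambda>p. act p v)" for x y
    using that assms by (auto simp: act_plus[symmetric])
qed (use assms in \<open>auto simp: act_mult[symmetric]\<close>)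

section \<open>Spans of sequences\<close>

text \<open>
  The recursion is on the number of members of the sequence that are used; it yields the filtration
  along which the arguments about \<open>f\<close> proceed.
\<close>

primrec span_upto :: "(nat \<Rightarrow> 'v) \<Rightarrow> nat \<Rightarrow> 'v set" where
  "span_upto w 0 = {\<zero>}"
| "span_upto w (Suc n) = {c \<cdot> w n \<oplus> u | c u. u \<in> span_upto w n}"

definition seq_span :: "(nat \<Rightarrow> 'v) \<Rightarrow> 'v set" where
  "seq_span w = (\<Union>n. span_upto w n)"

context
  fixes w :: "nat \<Rightarrow> 'v"
  assumes w: "\<And>i. w i \<in> carrier M"
begin

lemma span_upto_closed: "u \<in> span_upto w n \<Longrightarrow> u \<in> carrier M"
  by (induction n arbitrary: u) (auto simp: w)

lemma span_upto_Suc: "span_upto w n \<subseteq> span_upto w (Suc n)"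
proof
  fix u assume "u \<in> span_upto w n"
  moreover have "u = 0 \<cdot> w n \<oplus> u" using span_upto_closed[of u n] calculation w by simp
  ultimately show "u \<in> span_upto w (Suc n)" unfolding span_upto.simps by blast
qed

lemma span_upto_mono: "m \<le> n \<Longrightarrow> span_upto w m \<subseteq> span_upto w n"
  using span_upto_Suc lift_Suc_mono_le by blast

lemma span_upto_zero: "\<zero> \<in> span_upto w n"
  using span_upto_mono[of 0 n] by auto

lemma span_upto_basis: "w n \<in> span_upto w (Suc n)"
proof -
  have "w n = 1 \<cdot> w n \<oplus> \<zero>" using w[of n] by simp
  then show ?thesis unfolding span_upto.simps using span_upto_zero by blast
qed

lemma span_upto_add: "\<lbrakk>u \<in> span_upto w n; v \<in> span_upto w n\<rbrakk> \<Longrightarrow> u \<oplus> v \<in> span_upto w n"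
proof (induction n arbitrary: u v)
  case (Suc n)
  then obtain c u' d v' where *: "u = c \<cdot> w n \<oplus> u'" "v = d \<cdot> w n \<oplus> v'"
    "u' \<in> span_upto w n" "v' \<in> span_upto w n" by auto
  then have "u \<oplus> v = (c + d) \<cdot> w n \<oplus> (u' \<oplus> v')"
    using w span_upto_closed by (simp add: scale_add_left a_ac)
  then show ?case using Suc.IH * by auto
qed simp

lemma span_upto_scale: "u \<in> span_upto w n \<Longrightarrow> c \<cdot> u \<in> span_upto w n"
proof (induction n arbitrary: u)
  case (Suc n)
  then obtain d v where *: "u = d \<cdot> w n \<oplus> v" "v \<in> span_upto w n" by auto
  then have "c \<cdot> u = (c * d) \<cdot> w n \<oplus> c \<cdot> v"
    using w span_upto_closed by simp
  then show ?case using Suc.IH * by auto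
qed simp

lemma seq_span_subset: "seq_span w \<subseteq> carrier M"
  using span_upto_closed by (auto simp: seq_span_def)

lemma seq_span_zero: "\<zero> \<in> seq_span w"
  using span_upto_zero by (auto simp: seq_span_def)

lemma seq_span_basis: "w n \<in> seq_span w"
  using span_upto_basis[of n] unfolding seq_span_def by blast

lemma seq_span_add:
  assumes "u \<in> seq_span w" "v \<in> seq_span w"
  shows "u \<oplus> v \<in> seq_span w"
proof -
  obtain m n where "u \<in> span_upto w m" "v \<in> span_upto w n" using assms by (auto simp: seq_span_def)
  then have "u \<oplus> v \<in> span_upto w (max m n)"
    using span_upto_mono[of m "max m n"] span_upto_mono[of n "max m n"]
    by (intro span_upto_add) auto
  then show ?thesis by (auto simp: seq_span_def)
qed

lemma seq_span_scale: "u \<in> seq_span w \<Longrightarrow> c \<cdot> u \<in> seq_span w"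
  using span_upto_scale by (auto simp: seq_span_def)

lemma seq_span_induct:
  assumes W: "\<zero> \<in> W" "\<And>u v. \<lbrakk>u \<in> W; v \<in> W\<rbrakk> \<Longrightarrow> u \<oplus> v \<in> W" "\<And>c u. u \<in> W \<Longrightarrow> c \<cdot> u \<in> W"
    and "\<And>i. w i \<in> W"
  shows "seq_span w \<subseteq> W"
proof -
  have "span_upto w n \<subseteq> W" for n
    by (induction n) (use assms in auto)
  then show ?thesis by (auto simp: seq_span_def)
qed

lemma seq_span_act:
  assumes "\<And>i. act p (w i) \<in> seq_span w" "u \<in> seq_span w"
  shows "act p u \<in> seq_span w"
proof -
  have "seq_span w \<subseteq> {u \<in> carrier M. act p u \<in> seq_span w}"
    by (rule seq_span_induct) (auto simp: w assms seq_span_zero seq_span_add seq_span_scale act_scale)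
  then show ?thesis using assms(2) by blast
qed

end

end

section \<open>Sequences lowered by f\<close>

text \<open>
  A sequence along which \<open>f\<close> steps down with nonzero factors until it is killed. These data
  determine the action of \<open>f\<close> on the span completely, and in particular force linear independence.
\<close>

locale lowering_ladder = uq_module q M
  for q :: complex and M :: "(uq_gen free_alg set, 'v, 'm) module_scheme" (structure) +
  fixes w :: "nat \<Rightarrow> 'v" and c :: "nat \<Rightarrow> complex"
  assumes ladder_closed [simp, intro]: "w i \<in> carrier M" and bottom: "w 0 \<noteq> \<zero>"
    and F_bottom: "F (w 0) = \<zero>" and F_Suc: "F (w (Suc i)) = c i \<cdot> w i" and c_nonzero: "c i \<noteq> 0"
begin

lemmas span_upto_closed [simp] = span_upto_closed[of w, OF ladder_closed]
lemmas seq_span_closed = seq_span_subset[of w, OF ladder_closed, THEN subsetD]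

lemma F_span_upto: "u \<in> span_upto w (Suc n) \<Longrightarrow> F u \<in> span_upto w n"
proof (induction n arbitrary: u)
  case (Suc n)
  then obtain d v where *: "u = d \<cdot> w (Suc n) \<oplus> v" "v \<in> span_upto w (Suc n)" by auto
  then have "F u = (d * c n) \<cdot> w n \<oplus> F v" by (simp del: span_upto.simps add: F_Suc)
  then show ?case using Suc.IH[OF *(2)] unfolding span_upto.simps(2)[of w n] by blast
qed (auto simp: F_bottom)

lemma F_seq_span: "u \<in> seq_span w \<Longrightarrow> F u \<in> seq_span w"
proof (rule seq_span_act)
  show "F (w i) \<in> seq_span w" for i
    by (cases i) (simp_all add: F_bottom F_Suc seq_span_zero seq_span_scale seq_span_basis)
qed auto

lemma funpow_F_span_upto: "u \<in> span_upto w n \<Longrightarrow> (F ^^ n) u = \<zero>"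
proof (induction n arbitrary: u)
  case (Suc n)
  then have "(F ^^ n) (F u) = \<zero>" using F_span_upto by blast
  then show ?case by (simp add: funpow_swap1)
qed simp

lemma funpow_F_seq_span: "u \<in> seq_span w \<Longrightarrow> \<exists>n. (F ^^ n) u = \<zero>"
  using funpow_F_span_upto by (auto simp: seq_span_def)

lemma funpow_F_ladder: "\<exists>d. d \<noteq> 0 \<and> (F ^^ n) (w n) = d \<cdot> w 0"
proof (induction n)
  case 0
  show ?case by (rule exI[of _ 1]) (simp add: scale_one)
next
  case (Suc n)
  then obtain d where "d \<noteq> 0" "(F ^^ n) (w n) = d \<cdot> w 0" by blast
  then have "c n * d \<noteq> 0" "(F ^^ Suc n) (w (Suc n)) = (c n * d) \<cdot> w 0"
    using c_nonzero by (simp_all add: funpow_Suc_right F_Suc del: funpow.simps)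
  then show ?case by blast
qed

text \<open>
  The \<open>n\<close>-th power of \<open>f\<close> sees only the coefficient at \<open>w n\<close>: it kills all earlier members and takes
  \<open>w n\<close> to a nonzero multiple of the nonzero vector \<open>w 0\<close>.
\<close>

lemma span_upto_kernel:
  assumes "u \<in> span_upto w (Suc n)" "(F ^^ n) u = \<zero>"
  shows "u \<in> span_upto w n"
proof -
  obtain a v where *: "u = a \<cdot> w n \<oplus> v" "v \<in> span_upto w n" using assms by auto
  obtain d where d: "d \<noteq> 0" "(F ^^ n) (w n) = d \<cdot> w 0" using funpow_F_ladder by blast
  have "(F ^^ n) u = (a * d) \<cdot> w 0"
    using * d by (simp add: funpow_F_span_upto)
  then have "(a * d) \<cdot> w 0 = \<zero>" using assms(2) by simp
  then have "a = 0" using d bottom by (simp add: scale_eq_zero_iff)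
  then show ?thesis using * by simp
qed

text \<open>
  A vector killed by \<open>f\<close> is killed by all higher powers, so its top coefficients vanish one after
  the other until only the multiple of \<open>w 0\<close> is left.
\<close>

lemma F_kernel:
  assumes "u \<in> seq_span w" "F u = \<zero>"
  shows "\<exists>a. u = a \<cdot> w 0"
proof -
  have "u \<in> span_upto w 1" if "u \<in> span_upto w n" for n
    using that
  proof (induction n)
    case 0
    then show ?case using span_upto_mono[of w 0 1] by auto
  next
    case (Suc n)
    show ?case
    proof (cases n)
      case 0
      then show ?thesis using Suc by simp
    next
      case (Suc m)
      have "(F ^^ n) u = \<zero>" using assms(2) Suc by (simp add: funpow_Suc_right del: funpow.simps)
      then show ?thesis using span_upto_kernel Suc.IH Suc.prems by blast
    qed
  qed
  then show ?thesis using assms(1) by (auto simp: seq_span_def)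
qed

lemma F_surj:
  assumes "u \<in> seq_span w"
  shows "\<exists>v\<in>seq_span w. F v = u"
proof -
  have "seq_span w \<subseteq> {u. \<exists>v\<in>seq_span w. F v = u}"
  proof (rule seq_span_induct)
    show "\<zero> \<in> {u. \<exists>v\<in>seq_span w. F v = u}"
      using seq_span_zero[of w] by (auto intro!: bexI[of _ \<zero>])
  next
    fix u v assume "u \<in> {u. \<exists>v\<in>seq_span w. F v = u}" "v \<in> {u. \<exists>v\<in>seq_span w. F v = u}"
    then obtain u' v' where "u' \<in> seq_span w" "v' \<in> seq_span w" "F u' = u" "F v' = v" by auto
    then show "u \<oplus> v \<in> {u. \<exists>v\<in>seq_span w. F v = u}"
      by (auto intro!: bexI[of _ "u' \<oplus> v'"] simp: seq_span_closed seq_span_add)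
  next
    fix a u assume "u \<in> {u. \<exists>v\<in>seq_span w. F v = u}"
    then obtain u' where "u' \<in> seq_span w" "F u' = u" by auto
    then show "a \<cdot> u \<in> {u. \<exists>v\<in>seq_span w. F v = u}"
      by (auto intro!: bexI[of _ "a \<cdot> u'"] simp: seq_span_closed seq_span_scale)
  next
    fix i
    show "w i \<in> {u. \<exists>v\<in>seq_span w. F v = u}"
      using c_nonzero[of i]
      by (auto intro!: bexI[of _ "inverse (c i) \<cdot> w (Suc i)"] simp: F_Suc seq_span_basis seq_span_scale)
  qed auto
  then show ?thesis using assms by blast
qed

text \<open>
  Apply the last power of \<open>f\<close> that does not kill \<open>u\<close>: the result lies in the kernel of \<open>f\<close>, hence is a
  nonzero multiple of \<open>w 0\<close>.
\<close>

lemma reach_bottom: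
  assumes u: "u \<in> seq_span w" "u \<noteq> \<zero>"
  shows "\<exists>p. act p u = w 0"
proof -
  obtain n where n: "(F ^^ n) u = \<zero>" "\<And>m. m < n \<Longrightarrow> (F ^^ m) u \<noteq> \<zero>"
    using funpow_F_seq_span[OF u(1)] exists_least_iff[of "\<lambda>n. (F ^^ n) u = \<zero>"] by auto
  then obtain m where m: "n = Suc m" using u(2) by (cases n) auto
  have "(F ^^ m) u \<in> seq_span w"
    by (induction m) (use u F_seq_span in auto)
  then obtain a where a: "(F ^^ m) u = a \<cdot> w 0" using F_kernel n(1) m by auto
  moreover have "a \<noteq> 0" using a n(2) m by auto
  ultimately have "act (scal (inverse a) * gen GenF ^ m) u = w 0"
    using u(1) by (simp add: act_mult act_power seq_span_closed)
  then show ?thesis by blast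
qed

end

section \<open>Lowest weight modules\<close>

text \<open>
  The factor in \<open>f e\<^bsup>i+1\<^esup> w = c\<^sub>i e\<^sup>i w\<close> for a vector of weight \<open>\<mu>\<close> with \<open>e f w = 0\<close>: moving \<open>f\<close> to the
  right past one \<open>e\<close> at a time contributes one commutator \<open>[f, e]\<close> for each of the weights
  \<open>\<mu> q\<^bsup>2j\<^esup>\<close> met on the way.
\<close>

definition lowering_coeff :: "complex \<Rightarrow> complex \<Rightarrow> nat \<Rightarrow> complex" where
  "lowering_coeff q \<mu> i = - (\<Sum>j\<le>i. \<mu> * q ^ (2 * j) - inverse (\<mu> * q ^ (2 * j))) / (q - inverse q)"

text \<open>
  For the weight \<open>q\<^sup>n\<close> the sum of commutators telescopes into a product, from which its nonvanishing
  can be read off.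
\<close>

lemma lowering_coeff_product_form:
  fixes q :: complex
  assumes "q \<noteq> 0"
  shows "(\<Sum>j\<le>i. q ^ n * q ^ (2 * j) - inverse (q ^ n * q ^ (2 * j))) * (q - inverse q) =
    (q ^ Suc i - inverse (q ^ Suc i)) * (q ^ (n + i) - inverse (q ^ (n + i)))"
proof (induction i)
  case 0
  show ?case by (simp add: mult.commute)
next
  case (Suc i)
  define A N where "A = q ^ i" and "N = q ^ n"
  have nz: "A \<noteq> 0" "N \<noteq> 0" using assms by (simp_all add: A_def N_def)
  have e: "q ^ (2 * Suc i) = (q * A)\<^sup>2" "q ^ Suc i = q * A" "q ^ (n + i) = N * A"
    "q ^ Suc (Suc i) = q * (q * A)" "q ^ (n + Suc i) = N * (q * A)"
    by (simp_all add: A_def N_def power_add power_mult power2_eq_square power_mult_distrib mult_ac)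
  have "(\<Sum>j\<le>Suc i. q ^ n * q ^ (2 * j) - inverse (q ^ n * q ^ (2 * j))) * (q - inverse q) =
      (q * A - inverse (q * A)) * (N * A - inverse (N * A))
      + (N * (q * A)\<^sup>2 - inverse (N * (q * A)\<^sup>2)) * (q - inverse q)"
    using Suc by (simp only: sum.atMost_Suc distrib_right e N_def[symmetric])
  also have "\<dots> = (q * (q * A) - inverse (q * (q * A))) * (N * (q * A) - inverse (N * (q * A)))"
    using assms nz by (simp add: field_simps power2_eq_square)
  finally show ?case by (simp only: e)
qed

lemma lowering_coeff_nonzero:
  assumes "q \<noteq> 0" and root: "\<And>m::nat. m > 0 \<Longrightarrow> q ^ m \<noteq> 1" and "n \<ge> 1"
  shows "lowering_coeff q (q ^ n) i \<noteq> 0"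
proof -
  have "q ^ m - inverse (q ^ m) \<noteq> 0" if "m > 0" for m
  proof
    assume "q ^ m - inverse (q ^ m) = 0"
    then have "q ^ m * q ^ m = 1" using \<open>q \<noteq> 0\<close> by (simp add: field_simps)
    then show False using root[of "m + m"] that by (simp add: power_add)
  qed
  from this[of "Suc i"] this[of "n + i"] this[of 1] \<open>n \<ge> 1\<close> show ?thesis
    using lowering_coeff_product_form[OF \<open>q \<noteq> 0\<close>, of n i] by (auto simp: lowering_coeff_def)
qed

text \<open>
  Requiring \<open>e f w = 0\<close> instead of \<open>f w = 0\<close> covers, besides lowest weight vectors, the generator
  \<open>y\<close> of the zeroth summand: \<open>f y\<close> is a nonzero constant, but constants are killed by \<open>e\<close>.
\<close>

locale weight_vector = uq_module q M
  for q :: complex and M :: "(uq_gen free_alg set, 'v, 'm) module_scheme" (structure) +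
  fixes \<mu> :: complex and w :: 'v
  assumes q_nonzero: "q \<noteq> 0" and \<mu>_nonzero: "\<mu> \<noteq> 0"
    and w_closed [simp, intro]: "w \<in> carrier M" and K_w: "K w = \<mu> \<cdot> w" and E_F_w: "E (F w) = \<zero>"
begin

lemma K_raised: "K ((E ^^ i) w) = (\<mu> * q ^ (2 * i)) \<cdot> (E ^^ i) w"
proof (induction i)
  case (Suc i)
  then show ?case by (simp add: K_E power2_eq_square mult_ac)
qed (simp add: K_w)

lemma Kinv_raised: "Kinv ((E ^^ i) w) = inverse (\<mu> * q ^ (2 * i)) \<cdot> (E ^^ i) w"
  using q_nonzero \<mu>_nonzero by (intro Kinv_eigen) (auto simp: K_raised)

lemma E_F_raised:
  "E (F ((E ^^ i) w)) = F (E ((E ^^ i) w)) \<oplus>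
    ((\<mu> * q ^ (2 * i) - inverse (\<mu> * q ^ (2 * i))) / (q - inverse q)) \<cdot> (E ^^ i) w"
proof -
  have "K ((E ^^ i) w) \<oplus> (-1) \<cdot> Kinv ((E ^^ i) w) =
      (\<mu> * q ^ (2 * i) - inverse (\<mu> * q ^ (2 * i))) \<cdot> (E ^^ i) w"
    by (simp only: K_raised Kinv_raised diff_conv_add_uminus scale_add_left scale_scale
        act_funpow_closed w_closed mult_minus1)
  then show ?thesis by (simp add: E_F)
qed

lemma F_raised_Suc: "F ((E ^^ Suc i) w) = lowering_coeff q \<mu> i \<cdot> (E ^^ i) w"
proof (induction i)
  case 0
  have "\<zero> = F (E w) \<oplus> ((\<mu> - inverse \<mu>) / (q - inverse q)) \<cdot> w"
    using E_F_raised[of 0] E_F_w by simp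
  then have "F (E w) = \<ominus> (((\<mu> - inverse \<mu>) / (q - inverse q)) \<cdot> w)"
    by (metis act_closed w_closed minus_equality)
  then show ?case by (simp add: minus_eq_scale lowering_coeff_def)
next
  case (Suc i)
  define x where "x = (\<mu> * q ^ (2 * Suc i) - inverse (\<mu> * q ^ (2 * Suc i))) / (q - inverse q)"
  define v where "v = (E ^^ Suc i) w"
  have v: "v \<in> carrier M" by (simp add: v_def del: funpow.simps)
  have "E (F v) = lowering_coeff q \<mu> i \<cdot> v"
    using Suc by (simp add: v_def)
  then have "lowering_coeff q \<mu> i \<cdot> v = F (E v) \<oplus> x \<cdot> v"
    using E_F_raised[of "Suc i"] by (simp add: x_def v_def)
  then have "lowering_coeff q \<mu> i \<cdot> v \<oplus> (- x) \<cdot> v = F (E v) \<oplus> (x \<cdot> v \<oplus> (- x) \<cdot> v)"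
    using v by (simp add: a_assoc)
  then have "F (E v) = (lowering_coeff q \<mu> i - x) \<cdot> v"
    using v by (simp add: scale_add_left[symmetric])
  moreover have "lowering_coeff q \<mu> (Suc i) = lowering_coeff q \<mu> i - x"
    by (simp add: lowering_coeff_def x_def add_divide_distrib diff_divide_distrib)
  ultimately show ?case by (simp add: v_def)
qed

end

locale lowest_weight = weight_vector q M \<mu> w
  for q :: complex and M :: "(uq_gen free_alg set, 'v, 'm) module_scheme" (structure)
    and \<mu> :: complex and w :: 'v +
  assumes F_w: "F w = \<zero>" and w_nonzero: "w \<noteq> \<zero>" and generic: "\<And>i. lowering_coeff q \<mu> i \<noteq> 0"
begin

sublocale lowering_ladder q M "\<lambda>i. (E ^^ i) w" "lowering_coeff q \<mu>"
  by unfold_locales (use F_w w_nonzero generic F_raised_Suc in auto)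

abbreviation "raised_span \<equiv> seq_span (\<lambda>i. (E ^^ i) w)"

text \<open>
  Each \<open>e\<^sup>i w\<close> is an eigenvector of \<open>k\<close>, moves up under \<open>e\<close> and down under \<open>f\<close>, so the span is
  stable under all generators.
\<close>

lemma raised_span_submodule: "submodule raised_span (uq q) M"
proof (rule submodule_generatorsI)
  fix g v assume v: "v \<in> raised_span"
  show "act (gen g) v \<in> raised_span"
  proof (rule seq_span_act[OF _ _ v])
    fix i
    have "E ((E ^^ i) w) \<in> raised_span"
      using seq_span_basis[of "\<lambda>i. (E ^^ i) w" "Suc i"] by simp
    moreover have "F ((E ^^ i) w) \<in> raised_span"
      using F_seq_span seq_span_basis[of "\<lambda>i. (E ^^ i) w" i] by simp
    moreover have "c \<cdot> (E ^^ i) w \<in> raised_span" for c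
      using seq_span_basis[of "\<lambda>i. (E ^^ i) w" i] by (simp add: seq_span_scale)
    ultimately show "act (gen g) ((E ^^ i) w) \<in> raised_span"
      by (cases g) (simp_all add: K_raised Kinv_raised)
  qed simp
qed (simp_all add: seq_span_subset seq_span_zero seq_span_add seq_span_scale)

lemma w_in_raised_span: "w \<in> raised_span"
  using seq_span_basis[of "\<lambda>i. (E ^^ i) w" 0] by simp

lemma raised_span_least:
  assumes "submodule W (uq q) M" "w \<in> W"
  shows "raised_span \<subseteq> W"
proof (rule seq_span_induct)
  show "(E ^^ i) w \<in> W" for i
    by (induction i) (use assms submodule_act in auto)
qed (use assms submoduleD submodule_act in auto)

lemma raised_span_eq_orbit: "raised_span = range (\<lambda>p. act p w)"
proof
  show "raised_span \<subseteq> range (\<lambda>p. act p w)"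
  proof (rule raised_span_least)
    show "w \<in> range (\<lambda>p. act p w)" by (rule range_eqI[of _ _ 1]) simp
  qed (simp add: cyclic_submodule)
  show "range (\<lambda>p. act p w) \<subseteq> raised_span"
    using submodule_act[OF raised_span_submodule w_in_raised_span] by blast
qed

lemma raised_span_eq_generated: "raised_span = generated_submodule (uq q) M {w}"
proof
  show "raised_span \<subseteq> generated_submodule (uq q) M {w}"
    using generated_submodule_submodule[of "{w}"] generated_submodule_superset[of "{w}" "uq q" M]
    by (intro raised_span_least) auto
  show "generated_submodule (uq q) M {w} \<subseteq> raised_span"
    using raised_span_submodule w_in_raised_span by (intro generated_submodule_least) auto
qed

end

locale cyclic_lowest_weight = lowest_weight +
  assumes cyclic: "carrier M = range (\<lambda>p. act p w)"
begin

lemma reach: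
  assumes "v \<in> carrier M" "v \<noteq> \<zero>"
  shows "\<exists>p. act p v = w"
  using reach_bottom[of v] assms by (simp add: raised_span_eq_orbit cyclic)

lemma simple: "simple_module (uq q) M"
proof (rule simple_moduleI)
  fix u v assume u: "u \<in> carrier M" and v: "v \<in> carrier M" "v \<noteq> \<zero>"
  obtain p' where "u = act p' w" using u cyclic by auto
  moreover obtain p where "act p v = w" using reach v by blast
  ultimately have "u = act (p' * p) v" using v by (simp add: act_mult)
  then show "\<exists>h\<in>carrier (uq q). u = h \<odot> v" unfolding act_def by blast
qed (use w_nonzero in auto)

end

lemma (in lowest_weight) restrict_raised_span:
  "cyclic_lowest_weight q (M\<lparr>carrier := raised_span\<rparr>) \<mu> w"
proof -
  note W = raised_span_submodule
  have "weight_vector q (M\<lparr>carrier := raised_span\<rparr>) \<mu> w"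
    by (intro weight_vector.intro weight_vector_axioms.intro restrict_uq_module[OF W])
      (simp_all add: restrict_act[OF W] w_in_raised_span q_nonzero \<mu>_nonzero K_w E_F_w)
  then show ?thesis
    by (intro cyclic_lowest_weight.intro lowest_weight.intro lowest_weight_axioms.intro
        cyclic_lowest_weight_axioms.intro)
      (simp_all add: restrict_act[OF W] F_w w_nonzero generic raised_span_eq_orbit[symmetric])
qed

section \<open>Verma modules\<close>

definition verma_ideal :: "complex \<Rightarrow> complex \<Rightarrow> uq_gen free_alg set set" where
  "verma_ideal q \<mu> = generated_submodule (uq q) (regular_module (uq q))
     {uq_f q, uq_k q \<ominus>\<^bsub>uq q\<^esub> (\<mu> \<odot>\<^bsub>uq q\<^esub> \<one>\<^bsub>uq q\<^esub>)}"

lemma verma_ideal_generators: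
  "{uq_f q, uq_k q \<ominus>\<^bsub>uq q\<^esub> (\<mu> \<odot>\<^bsub>uq q\<^esub> \<one>\<^bsub>uq q\<^esub>)} =
    {uq_class q (gen GenF), uq_class q (gen GenK - scal \<mu>)}"
proof -
  interpret ring "uq q" by (rule ring_uq)
  have "\<ominus>\<^bsub>uq q\<^esub> uq_class q p = uq_class q (- p)" for p
    by (rule minus_equality) (simp_all add: uq_class_add uq_class_zero)
  then show ?thesis
    by (simp add: uq_f_def uq_k_def a_minus_def uq_class_one uq_class_smult uq_class_add)
qed

lemma regular_uq_module: "uq_module q (regular_module (uq q))"
  by (simp add: uq_module_def regular_left_module ring_uq)

lemma verma_ideal_submodule: "submodule (verma_ideal q \<mu>) (uq q) (regular_module (uq q))"
proof -
  interpret uq_module q "regular_module (uq q)" by (rule regular_uq_module)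
  show ?thesis
    unfolding verma_ideal_def verma_ideal_generators
    by (rule generated_submodule_submodule) (simp add: regular_module_simps)
qed

lemma verma_ideal_contains:
  "{uq_class q (gen GenF), uq_class q (gen GenK - scal \<mu>)} \<subseteq> verma_ideal q \<mu>"
  unfolding verma_ideal_def verma_ideal_generators by (rule generated_submodule_superset)

lemma verma_eq: "verma q \<mu> = quotient_module (regular_module (uq q)) (verma_ideal q \<mu>)"
  by (simp add: verma_def verma_ideal_def)

definition verma_class :: "complex \<Rightarrow> complex \<Rightarrow> uq_gen free_alg \<Rightarrow> uq_gen free_alg set set" where
  "verma_class q \<mu> p = verma_ideal q \<mu> +>\<^bsub>regular_module (uq q)\<^esub> uq_class q p"

lemma verma_uq_module: "uq_module q (verma q \<mu>)"
  using uq_module.quotient_uq_module[OF regular_uq_module verma_ideal_submodule]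
  by (simp add: verma_eq)

context
  fixes q \<mu> :: complex
begin

interpretation R: uq_module q "regular_module (uq q)" by (rule regular_uq_module)
interpretation V: uq_module q "verma q \<mu>" by (rule verma_uq_module)

lemma verma_carrier: "carrier (verma q \<mu>) = range (verma_class q \<mu>)"
  by (auto simp: verma_eq R.quotient_carrier regular_module_simps uq_carrier verma_class_def image_iff)

lemma verma_class_add: "verma_class q \<mu> p \<oplus>\<^bsub>verma q \<mu>\<^esub> verma_class q \<mu> p' = verma_class q \<mu> (p + p')"
  using R.quotient_add[OF verma_ideal_submodule, of "uq_class q p" "uq_class q p'"]
  by (simp add: verma_eq verma_class_def regular_module_simps uq_class_add)

lemma verma_act: "uq_class q p \<odot>\<^bsub>verma q \<mu>\<^esub> verma_class q \<mu> p' = verma_class q \<mu> (p * p')"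
  using R.quotient_smult[OF verma_ideal_submodule, of "uq_class q p" "uq_class q p'"]
  by (simp add: verma_eq verma_class_def regular_module_simps uq_class_mult)

lemma verma_class_eq_zero_iff: "verma_class q \<mu> p = \<zero>\<^bsub>verma q \<mu>\<^esub> \<longleftrightarrow> uq_class q p \<in> verma_ideal q \<mu>"
  using R.quotient_class_zero[OF verma_ideal_submodule, of "uq_class q p"]
  by (simp add: verma_eq verma_class_def regular_module_simps R.quotient_zero)

lemma verma_class_eq_iff:
  "verma_class q \<mu> p = verma_class q \<mu> p' \<longleftrightarrow> uq_class q (p - p') \<in> verma_ideal q \<mu>"
proof -
  have "\<ominus>\<^bsub>regular_module (uq q)\<^esub> uq_class q p' = uq_class q (- p')"
    by (rule R.minus_equality) (simp_all add: regular_module_simps uq_class_add uq_class_zero)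
  then have "uq_class q p \<ominus>\<^bsub>regular_module (uq q)\<^esub> uq_class q p' = uq_class q (p - p')"
    by (simp add: a_minus_def regular_module_simps uq_class_add)
  then show ?thesis
    using R.quotient_class_eq_iff[OF verma_ideal_submodule, of "uq_class q p" "uq_class q p'"]
    by (simp add: verma_class_def regular_module_simps)
qed

text \<open>
  The universal property of the Verma module: its relations hold for any vector of the right weight
  that is killed by \<open>f\<close>.
\<close>

lemma verma_ideal_subset_annihilator:
  assumes "uq_module q M" "w \<in> carrier M"
    and "uq_module.act q M (gen GenF) w = \<zero>\<^bsub>M\<^esub>"
    and "uq_module.act q M (gen GenK) w = uq_module.act q M (scal \<mu>) w"
    and "uq_class q p \<in> verma_ideal q \<mu>"
  shows "uq_module.act q M p w = \<zero>\<^bsub>M\<^esub>"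
proof -
  interpret uq_module q M by fact
  define A where "A = {h \<in> carrier (uq q). h \<odot>\<^bsub>M\<^esub> w = \<zero>\<^bsub>M\<^esub>}"
  have "submodule A (uq q) (regular_module (uq q))"
    using assms(2)
    by (intro R.submoduleI)
      (auto simp: A_def regular_module_simps smult_l_distr smult_assoc)
  moreover have "act (gen GenK - scal \<mu>) w = \<zero>\<^bsub>M\<^esub>"
    using assms(2,4) act_plus[of w "gen GenK - scal \<mu>" "scal \<mu>"]
    by (simp add: add.l_cancel_one)
  ultimately have "verma_ideal q \<mu> \<subseteq> A"
    unfolding verma_ideal_def verma_ideal_generators
    using assms(3) by (intro generated_submodule_least) (auto simp: A_def act_def)
  then show ?thesis using assms(5) by (auto simp: A_def act_def)
qed

end

context cyclic_lowest_weight
begin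

interpretation V: uq_module q "verma q \<mu>" by (rule verma_uq_module)

lemma verma_ideal_annihilates: "uq_class q p \<in> verma_ideal q \<mu> \<Longrightarrow> act p w = \<zero>"
  by (rule verma_ideal_subset_annihilator[OF uq_module_axioms w_closed F_w K_w])

text \<open>
  The one point that is not formal is that the generator is nonzero. It holds because the left ideal
  annihilates \<open>w \<noteq> 0\<close> and hence does not contain the unit.
\<close>

lemma verma_cyclic_lowest_weight: "cyclic_lowest_weight q (verma q \<mu>) \<mu> (verma_class q \<mu> 1)"
proof (unfold_locales)
  have gens: "uq_class q (gen GenF) \<in> verma_ideal q \<mu>" "uq_class q (gen GenK - scal \<mu>) \<in> verma_ideal q \<mu>"
    using verma_ideal_contains by auto
  note S = V.act_def verma_act verma_carrier
  show c: "verma_class q \<mu> 1 \<in> carrier (verma q \<mu>)" by (auto simp: S)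
  show "V.K (verma_class q \<mu> 1) = V.scale \<mu> (verma_class q \<mu> 1)"
    using gens(2) by (simp add: S verma_class_eq_iff)
  show F: "V.F (verma_class q \<mu> 1) = \<zero>\<^bsub>verma q \<mu>\<^esub>"
    using gens(1) by (simp add: S verma_class_eq_zero_iff)
  show "V.E (V.F (verma_class q \<mu> 1)) = \<zero>\<^bsub>verma q \<mu>\<^esub>" by (simp add: F)
  show "verma_class q \<mu> 1 \<noteq> \<zero>\<^bsub>verma q \<mu>\<^esub>"
    using verma_ideal_annihilates[of 1] w_nonzero by (auto simp: verma_class_eq_zero_iff)
  show "carrier (verma q \<mu>) = range (\<lambda>p. V.act p (verma_class q \<mu> 1))"
    by (simp add: S)
qed (use q_nonzero \<mu>_nonzero generic in auto)

theorem verma_simple: "simple_module (uq q) (verma q \<mu>)"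
  by (rule cyclic_lowest_weight.simple[OF verma_cyclic_lowest_weight])

text \<open>
  If \<open>p\<close> annihilated \<open>w\<close> without lying in the left ideal, then by simplicity of the Verma module
  some multiple of \<open>p\<close> would be congruent to \<open>1\<close>, and \<open>w\<close> would vanish.
\<close>

lemma annihilator_eq: "act p w = \<zero> \<longleftrightarrow> uq_class q p \<in> verma_ideal q \<mu>"
proof
  assume p: "act p w = \<zero>"
  show "uq_class q p \<in> verma_ideal q \<mu>"
  proof (rule ccontr)
    assume "uq_class q p \<notin> verma_ideal q \<mu>"
    then obtain p' where "V.act p' (verma_class q \<mu> p) = verma_class q \<mu> 1"
      using cyclic_lowest_weight.reach[OF verma_cyclic_lowest_weight, of "verma_class q \<mu> p"] by (auto simp: verma_class_eq_zero_iff verma_carrier)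
    then have "uq_class q (p' * p - 1) \<in> verma_ideal q \<mu>"
      by (simp add: V.act_def verma_act verma_class_eq_iff)
    then have "act (p' * p - 1) w = \<zero>" by (rule verma_ideal_annihilates)
    then have "act (p' * p) w = w"
      using act_plus[of w "p' * p - 1" 1] by simp
    then show False using p w_nonzero by (simp add: act_mult)
  qed
qed (rule verma_ideal_annihilates)

text \<open>
  Both modules are the quotient of the enveloping algebra by the annihilator of \<open>w\<close>.
\<close>

theorem isomorphic_verma: "module_isomorphic (uq q) M (verma q \<mu>)"
proof -
  \<comment> \<open>Any choice of \<open>p\<close> with \<open>p w = v\<close> gives the same class, see \<open>eq_iff\<close>.\<close>
  define \<phi> where "\<phi> v = verma_class q \<mu> (SOME p. act p w = v)" for v
  have eq_iff: "act p w = act p' w \<longleftrightarrow> verma_class q \<mu> p = verma_class q \<mu> p'" for p p'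
  proof -
    have "act p w = act (p - p') w \<oplus> act p' w" using act_plus[of w "p - p'" p'] by simp
    then have "act p w = act p' w \<longleftrightarrow> act (p - p') w = \<zero>"
      by (simp add: add.r_cancel_one add.l_cancel_one)
    then show ?thesis by (simp add: verma_class_eq_iff annihilator_eq)
  qed
  have \<phi>: "\<phi> (act p w) = verma_class q \<mu> p" for p
    unfolding \<phi>_def by (subst eq_iff[symmetric]) (rule someI, rule refl)
  show ?thesis
    unfolding module_isomorphic_def
  proof (intro exI[of _ \<phi>] conjI ballI)
    show "bij_betw \<phi> (carrier M) (carrier (verma q \<mu>))"
      by (auto simp: bij_betw_def inj_on_def cyclic verma_carrier \<phi> eq_iff image_image)
  next
    fix u v assume "u \<in> carrier M" "v \<in> carrier M"
    then obtain p p' where "u = act p w" "v = act p' w" by (auto simp: cyclic)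
    moreover have "\<phi> (act p w \<oplus> act p' w) = verma_class q \<mu> (p + p')"
      using \<phi>[of "p + p'"] by (simp only: act_plus w_closed)
    ultimately show "\<phi> (u \<oplus> v) = \<phi> u \<oplus>\<^bsub>verma q \<mu>\<^esub> \<phi> v"
      by (simp add: \<phi> verma_class_add)
  next
    fix h v assume "h \<in> carrier (uq q)" "v \<in> carrier M"
    then obtain p p' where "h = uq_class q p" "v = act p' w" by (auto simp: cyclic uq_carrier)
    moreover have "\<phi> (act p (act p' w)) = uq_class q p \<odot>\<^bsub>verma q \<mu>\<^esub> \<phi> (act p' w)"
      by (simp add: act_mult[symmetric] \<phi> verma_act)
    ultimately show "\<phi> (h \<odot> v) = h \<odot>\<^bsub>verma q \<mu>\<^esub> \<phi> v"
      by (simp add: act_def)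
  qed
qed

end

section \<open>Direct sums of ladders\<close>

context uq_module
begin

lemma act_finsum:
  "f \<in> S \<rightarrow> carrier M \<Longrightarrow> act p (\<Oplus>i\<in>S. f i) = (\<Oplus>i\<in>S. act p (f i))"
proof (induction S rule: infinite_finite_induct)
  case (insert i S)
  then have "f i \<in> carrier M" "f \<in> S \<rightarrow> carrier M" "(\<lambda>i. act p (f i)) \<in> S \<rightarrow> carrier M" by auto
  then show ?case using insert by simp
qed simp_all

lemma finsum_support:
  assumes "finite S" "{i. v i \<noteq> \<zero>} \<subseteq> S" "\<And>i. v i \<in> carrier M"
  shows "(\<Oplus>i\<in>{i. v i \<noteq> \<zero>}. v i) = (\<Oplus>i\<in>S. v i)"
  using assms by (intro add.finprod_mono_neutral_cong_left) auto

end

text \<open>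
  Independence of the bottoms is assumed; that of all the vectors in the ladders follows from it.
\<close>

locale ladder_family = uq_module q M
  for q :: complex and M :: "(uq_gen free_alg set, 'v, 'm) module_scheme" (structure) +
  fixes w :: "nat \<Rightarrow> nat \<Rightarrow> 'v" and c :: "nat \<Rightarrow> nat \<Rightarrow> complex"
  assumes ladder: "lowering_ladder q M (w n) (c n)"
    and independent: "\<lbrakk>finite S; (\<Oplus>n\<in>S. a n \<cdot> w n 0) = \<zero>; n \<in> S\<rbrakk> \<Longrightarrow> a n = (0 :: complex)"
begin

definition total_span :: "'v set" where
  "total_span = {\<Oplus>n\<in>S. v n | S v. finite S \<and> (\<forall>n. v n \<in> seq_span (w n))}"

lemma w_closed [simp, intro]: "w n i \<in> carrier M"
  by (rule lowering_ladder.ladder_closed[OF ladder])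

lemma span_closed: "u \<in> seq_span (w n) \<Longrightarrow> u \<in> carrier M"
  using seq_span_subset[of "w n"] by auto

lemma total_span_induct [consumes 1, case_names span add]:
  assumes "u \<in> total_span" "\<And>n u. u \<in> seq_span (w n) \<Longrightarrow> P u"
    and "\<And>u v. \<lbrakk>u \<in> total_span; v \<in> total_span; P u; P v\<rbrakk> \<Longrightarrow> P (u \<oplus> v)"
  shows "P u"
proof -
  obtain S v where u: "u = (\<Oplus>n\<in>S. v n)" and S: "finite S" and v: "\<forall>n. v n \<in> seq_span (w n)"
    using assms(1) by (auto simp: total_span_def)
  have part: "(\<Oplus>n\<in>T. v n) \<in> total_span" if "finite T" for T
    using that v by (auto simp: total_span_def)
  have "P (\<Oplus>n\<in>S. v n)" using S
  proof (induction S)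
    case empty
    then show ?case using assms(2)[OF seq_span_zero[of "w 0"]] by simp
  next
    case (insert n S)
    have "v n \<in> carrier M" using v span_closed by blast
    then have "(\<Oplus>i\<in>{n}. v i) = v n" by simp
    then have "v n \<in> total_span" using part[of "{n}"] by simp
    then have "P (v n \<oplus> (\<Oplus>i\<in>S. v i))"
      using part[OF insert.hyps(1)] assms(2)[OF v[rule_format]] insert.IH by (rule assms(3))
    moreover have "v \<in> S \<rightarrow> carrier M" "v n \<in> carrier M" using v span_closed by blast+
    ultimately show ?case using insert.hyps by simp
  qed
  then show ?thesis using u by simp
qed

lemma total_spanI:
  assumes "u \<in> seq_span (w n)"
  shows "u \<in> total_span"
proof -
  define v where "v i = (if i = n then u else \<zero>)" for i
  have "\<forall>i. v i \<in> seq_span (w i)" using assms seq_span_zero by (simp add: v_def)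
  moreover have "u = (\<Oplus>i\<in>{n}. v i)" using assms span_closed by (simp add: v_def)
  ultimately show ?thesis unfolding total_span_def by blast
qed

text \<open>
  The form of decomposition in which uniqueness can be expected: summands are indexed by the support.
\<close>

lemma total_span_normal_form:
  "u \<in> total_span \<longleftrightarrow>
    (\<exists>v. (\<forall>n. v n \<in> seq_span (w n)) \<and> finite {n. v n \<noteq> \<zero>} \<and> u = (\<Oplus>n\<in>{n. v n \<noteq> \<zero>}. v n))"
proof
  assume "u \<in> total_span"
  then obtain S v where u: "u = (\<Oplus>n\<in>S. v n)" and S: "finite S" and v: "\<forall>n. v n \<in> seq_span (w n)"
    by (auto simp: total_span_def)
  define v' where "v' n = (if n \<in> S then v n else \<zero>)" for n
  have v': "v' n \<in> seq_span (w n)" for n using v seq_span_zero by (simp add: v'_def)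
  have supp: "{n. v' n \<noteq> \<zero>} \<subseteq> S" by (auto simp: v'_def)
  have "(\<Oplus>n\<in>{n. v' n \<noteq> \<zero>}. v' n) = (\<Oplus>n\<in>S. v' n)"
    using v' span_closed S supp by (intro finsum_support) auto
  also have "\<dots> = u" unfolding u using v span_closed by (intro finsum_cong') (auto simp: v'_def)
  finally have "u = (\<Oplus>n\<in>{n. v' n \<noteq> \<zero>}. v' n)" by simp
  moreover have "finite {n. v' n \<noteq> \<zero>}" using S supp finite_subset by blast
  ultimately show "\<exists>v. (\<forall>n. v n \<in> seq_span (w n)) \<and> finite {n. v n \<noteq> \<zero>} \<and> u = (\<Oplus>n\<in>{n. v n \<noteq> \<zero>}. v n)"
    using v' by blast
qed (auto simp: total_span_def)

lemma total_span_closed: "u \<in> total_span \<Longrightarrow> u \<in> carrier M"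
  using span_closed by (auto simp: total_span_def intro!: finsum_closed)

lemma total_span_add:
  assumes "u \<in> total_span" "v \<in> total_span"
  shows "u \<oplus> v \<in> total_span"
proof -
  obtain f where f: "\<forall>n. f n \<in> seq_span (w n)" "finite {n. f n \<noteq> \<zero>}" "u = (\<Oplus>n\<in>{n. f n \<noteq> \<zero>}. f n)"
    using assms(1) total_span_normal_form by auto
  obtain g where g: "\<forall>n. g n \<in> seq_span (w n)" "finite {n. g n \<noteq> \<zero>}" "v = (\<Oplus>n\<in>{n. g n \<noteq> \<zero>}. g n)"
    using assms(2) total_span_normal_form by auto
  define S where "S = {n. f n \<noteq> \<zero>} \<union> {n. g n \<noteq> \<zero>}"
  have S: "finite S" using f g by (simp add: S_def)
  have "u = (\<Oplus>n\<in>S. f n)" unfolding f(3)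
    using f span_closed S by (intro finsum_support) (auto simp: S_def)
  moreover have "v = (\<Oplus>n\<in>S. g n)" unfolding g(3)
    using g span_closed S by (intro finsum_support) (auto simp: S_def)
  moreover have "f \<in> S \<rightarrow> carrier M" "g \<in> S \<rightarrow> carrier M" using f(1) g(1) span_closed by blast+
  ultimately have "u \<oplus> v = (\<Oplus>n\<in>S. f n \<oplus> g n)"
    by (simp add: finsum_addf)
  then show ?thesis unfolding total_span_def using S f(1) g(1) seq_span_add by blast
qed

lemma total_span_scale: "u \<in> total_span \<Longrightarrow> a \<cdot> u \<in> total_span"
  by (induction rule: total_span_induct)
    (auto simp: total_span_closed total_span_add intro: total_spanI seq_span_scale)

lemma total_span_linear:
  assumes add: "\<And>u v. \<lbrakk>u \<in> carrier M; v \<in> carrier M\<rbrakk> \<Longrightarrow> T (u \<oplus> v) = T u \<oplus> T v"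
    and scale: "\<And>a u. u \<in> carrier M \<Longrightarrow> T (a \<cdot> u) = a \<cdot> T u"
    and basis: "\<And>n i. T (w n i) \<in> total_span" and zero: "T \<zero> = \<zero>" and u: "u \<in> total_span"
  shows "T u \<in> total_span"
  using u
proof (induction rule: total_span_induct)
  case (span n u)
  have "seq_span (w n) \<subseteq> {u \<in> carrier M. T u \<in> total_span}"
    using total_spanI[OF seq_span_zero]
    by (intro seq_span_induct) (auto simp: add scale basis zero total_span_add total_span_scale)
  then show ?case using span by blast
qed (simp add: add total_span_closed total_span_add)

lemma funpow_F_mono:
  assumes "(F ^^ m) u = \<zero>" "m \<le> n"
  shows "(F ^^ n) u = \<zero>"
proof -
  obtain d where "n = d + m" using assms(2) le_Suc_ex add.commute by metis
  then have "(F ^^ n) u = (F ^^ d) ((F ^^ m) u)" by (simp add: Nat.funpow_add)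
  then show ?thesis using assms(1) by simp
qed

lemma total_span_nilpotent: "u \<in> total_span \<Longrightarrow> \<exists>n. (F ^^ n) u = \<zero>"
proof (induction rule: total_span_induct)
  case (span n u)
  then show ?case by (rule lowering_ladder.funpow_F_seq_span[OF ladder])
next
  case (add u v)
  then obtain m n where "(F ^^ m) u = \<zero>" "(F ^^ n) v = \<zero>" by auto
  then have "(F ^^ max m n) u = \<zero>" "(F ^^ max m n) v = \<zero>"
    using funpow_F_mono[of m u "max m n"] funpow_F_mono[of n v "max m n"] by auto
  then have "(F ^^ max m n) (u \<oplus> v) = \<zero>"
    using add total_span_closed by simp
  then show ?case by blast
qed

text \<open>
  Induction on the power of \<open>f\<close> that kills the summands. Applying \<open>f\<close> to the relation lowers that
  power, so all \<open>f (v n)\<close> vanish; then each \<open>v n\<close> is a multiple of the bottom of its ladder, and the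
  bottoms are independent.
\<close>

lemma directness_bounded:
  assumes "finite S"
  shows "\<lbrakk>\<And>n. n \<in> S \<Longrightarrow> v n \<in> seq_span (w n); \<And>n. n \<in> S \<Longrightarrow> (F ^^ k) (v n) = \<zero>;
    (\<Oplus>n\<in>S. v n) = \<zero>; n \<in> S\<rbrakk> \<Longrightarrow> v n = \<zero>"
proof (induction k arbitrary: v n)
  case (Suc k)
  have cl: "v \<in> S \<rightarrow> carrier M" using Suc.prems(1) span_closed by auto
  have Fv: "F (v m) = \<zero>" if "m \<in> S" for m
  proof (rule Suc.IH[of "\<lambda>n. F (v n)", OF _ _ _ that])
    show "F (v n) \<in> seq_span (w n)" if "n \<in> S" for n
      using lowering_ladder.F_seq_span[OF ladder] Suc.prems(1) that by blast
    show "(F ^^ k) (F (v n)) = \<zero>" if "n \<in> S" for n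
      using Suc.prems(2)[OF that] by (simp add: funpow_Suc_right del: funpow.simps)
    show "(\<Oplus>n\<in>S. F (v n)) = \<zero>"
      using act_finsum[OF cl, of "gen GenF"] Suc.prems(3) by simp
  qed
  have "\<exists>a. v m = a \<cdot> w m 0" if "m \<in> S" for m
    using lowering_ladder.F_kernel[OF ladder] Suc.prems(1) Fv that by blast
  then obtain a where a: "\<And>m. m \<in> S \<Longrightarrow> v m = a m \<cdot> w m 0" by metis
  have "(\<Oplus>m\<in>S. a m \<cdot> w m 0) = (\<Oplus>m\<in>S. v m)"
    using a cl by (intro finsum_cong') auto
  then have "a n = 0" using independent[of S a n] assms Suc.prems by simp
  then show ?case using a Suc.prems(4) by simp
qed simp

theorem directness:
  assumes S: "finite S" and v: "\<And>n. n \<in> S \<Longrightarrow> v n \<in> seq_span (w n)"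
    and "(\<Oplus>n\<in>S. v n) = \<zero>" "n \<in> S"
  shows "v n = \<zero>"
proof -
  have "\<exists>k. (F ^^ k) (v m) = \<zero>" if "m \<in> S" for m
    using lowering_ladder.funpow_F_seq_span[OF ladder] v that by blast
  then obtain k where k: "\<And>m. m \<in> S \<Longrightarrow> (F ^^ k m) (v m) = \<zero>" by metis
  have "(F ^^ sum k S) (v m) = \<zero>" if "m \<in> S" for m
    using funpow_F_mono[OF k[OF that]] member_le_sum[of m S k] that S by simp
  then show ?thesis using directness_bounded[OF S, of v "sum k S" n] assms by blast
qed

lemma total_span_kernel:
  assumes "u \<in> total_span" "F u = \<zero>"
  shows "\<exists>S a. finite S \<and> u = (\<Oplus>n\<in>S. a n \<cdot> w n 0)"
proof -
  obtain S v where u: "u = (\<Oplus>n\<in>S. v n)" and S: "finite S" and v: "\<forall>n. v n \<in> seq_span (w n)"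
    using assms(1) by (auto simp: total_span_def)
  have cl: "v \<in> S \<rightarrow> carrier M" using v span_closed by auto
  have "F (v n) = \<zero>" if "n \<in> S" for n
  proof (rule directness[OF S, of "\<lambda>n. F (v n)", OF _ _ that])
    show "(\<Oplus>n\<in>S. F (v n)) = \<zero>"
      using act_finsum[OF cl, of "gen GenF"] assms(2) u by simp
  qed (use v lowering_ladder.F_seq_span[OF ladder] in blast)
  then have "\<exists>a. v m = a \<cdot> w m 0" if "m \<in> S" for m
    using lowering_ladder.F_kernel[OF ladder] v that by blast
  then obtain a where a: "\<And>m. m \<in> S \<Longrightarrow> v m = a m \<cdot> w m 0" by metis
  have "u = (\<Oplus>m\<in>S. a m \<cdot> w m 0)"
    unfolding u using a cl by (intro finsum_cong') auto
  then show ?thesis using S by blast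
qed

lemma total_span_F_surj: "u \<in> total_span \<Longrightarrow> \<exists>v\<in>total_span. F v = u"
proof (induction rule: total_span_induct)
  case (span n u)
  then show ?case using lowering_ladder.F_surj[OF ladder] total_spanI by blast
next
  case (add u v)
  then obtain u' v' where "u' \<in> total_span" "v' \<in> total_span" "F u' = u" "F v' = v" by blast
  then show ?case
    by (intro bexI[of _ "u' \<oplus> v'"]) (auto simp: total_span_closed total_span_add)
qed

text \<open>
  Given \<open>u\<close> killed by \<open>f\<^bsup>n+1\<^esup>\<close>, the vector \<open>f u\<close> lies in the sum by induction, and since \<open>f\<close> maps
  the sum onto itself, \<open>f u = f v\<close> for some \<open>v\<close> in the sum. The difference \<open>u - v\<close> lies in the kernel
  of \<open>f\<close>.
\<close>

lemma total_span_eq_carrier: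
  assumes nilpotent: "\<And>u. u \<in> carrier M \<Longrightarrow> \<exists>n. (F ^^ n) u = \<zero>"
    and kernel: "\<And>u. \<lbrakk>u \<in> carrier M; F u = \<zero>\<rbrakk> \<Longrightarrow> u \<in> total_span"
  shows "total_span = carrier M"
proof -
  have "u \<in> total_span" if "u \<in> carrier M" "(F ^^ n) u = \<zero>" for u n
    using that
  proof (induction n arbitrary: u)
    case 0
    then show ?case using kernel by simp
  next
    case (Suc n)
    have "F u \<in> total_span" using Suc by (simp add: funpow_Suc_right del: funpow.simps)
    then obtain v where v: "v \<in> total_span" "F v = F u" using total_span_F_surj by blast
    have vM: "v \<in> carrier M" using v total_span_closed by blast
    have "F (u \<oplus> \<ominus> v) = \<zero>" using Suc.prems v vM by (simp add: act_minus r_neg)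
    then have "u \<oplus> \<ominus> v \<in> total_span" using kernel Suc.prems vM by simp
    then have "(u \<oplus> \<ominus> v) \<oplus> v \<in> total_span" using total_span_add v by blast
    then show ?case using Suc.prems vM by (simp add: a_assoc l_neg)
  qed
  then show ?thesis using nilpotent total_span_closed by blast
qed

theorem internal_direct_sum_spans:
  assumes sub: "\<And>n. submodule (seq_span (w n)) (uq q) M" and total: "total_span = carrier M"
  shows "internal_direct_sum (uq q) M (\<lambda>n. seq_span (w n))"
  unfolding internal_direct_sum_def
proof (intro conjI allI ballI sub)
  fix m assume "m \<in> carrier M"
  then obtain v where v: "\<forall>n. v n \<in> seq_span (w n)" "finite {n. v n \<noteq> \<zero>}" "m = (\<Oplus>n\<in>{n. v n \<noteq> \<zero>}. v n)"
    using total total_span_normal_form by blast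
  show "\<exists>!v. (\<forall>n. v n \<in> seq_span (w n)) \<and> finite {n. v n \<noteq> \<zero>} \<and> m = (\<Oplus>n\<in>{n. v n \<noteq> \<zero>}. v n)"
  proof (rule ex1I[of _ v])
    show "(\<forall>n. v n \<in> seq_span (w n)) \<and> finite {n. v n \<noteq> \<zero>} \<and> m = (\<Oplus>n\<in>{n. v n \<noteq> \<zero>}. v n)"
      using v by blast
    fix v' assume v': "(\<forall>n. v' n \<in> seq_span (w n)) \<and> finite {n. v' n \<noteq> \<zero>} \<and> m = (\<Oplus>n\<in>{n. v' n \<noteq> \<zero>}. v' n)"
    define S where "S = {n. v n \<noteq> \<zero>} \<union> {n. v' n \<noteq> \<zero>}"
    have S: "finite S" using v v' by (simp add: S_def)
    have cl: "v n \<in> carrier M" "v' n \<in> carrier M" for n using v v' span_closed by auto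
    have m: "m = (\<Oplus>n\<in>S. v n)" unfolding v(3)
      using cl S by (intro finsum_support) (auto simp: S_def)
    have "m = (\<Oplus>n\<in>{n. v' n \<noteq> \<zero>}. v' n)" using v' by blast
    also have "\<dots> = (\<Oplus>n\<in>S. v' n)" using cl S by (intro finsum_support) (auto simp: S_def)
    finally have m': "m = (\<Oplus>n\<in>S. v' n)" .
    have "(\<Oplus>n\<in>S. v n \<oplus> (-1) \<cdot> v' n) = m \<oplus> (-1) \<cdot> m"
      using cl act_finsum[of v' S "scal (-1)"] m m' by (simp add: finsum_addf Pi_def)
    then have z: "(\<Oplus>n\<in>S. v n \<oplus> (-1) \<cdot> v' n) = \<zero>"
      using \<open>m \<in> carrier M\<close> by (simp add: minus_eq_scale[symmetric] r_neg)
    have "v n \<oplus> (-1) \<cdot> v' n = \<zero>" if "n \<in> S" for n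
      by (rule directness[OF S, of "\<lambda>n. v n \<oplus> (-1) \<cdot> v' n", OF _ z that])
        (use v v' in \<open>simp add: seq_span_add seq_span_scale\<close>)
    then have "v' n = v n" if "n \<in> S" for n
      using that cl[of n]
      by (metis (no_types) minus_eq_scale minus_equality minus_minus a_inv_closed)
    moreover have "v' n = v n" if "n \<notin> S" for n using that by (simp add: S_def)
    ultimately show "v' = v" by blast
  qed
qed

end

section \<open>The quantum plane\<close>

abbreviation plane_class :: "complex \<Rightarrow> qplane_gen free_alg \<Rightarrow> qplane_gen free_alg set" where
  "plane_class q \<equiv> presented_class (qplane_rels q)"

lemma plane_class_comm:
  "plane_class q (gen GenY * gen GenX * p) = plane_class q (scal q * gen GenX * gen GenY * p)"
proof -
  have "plane_class q (gen GenY * gen GenX) = plane_class q (scal q * gen GenX * gen GenY)"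
    by (rule presented_class_eqI) (simp add: qplane_rels_def)
  then show ?thesis by (metis presented_mult)
qed

text \<open>
  The case of interest is \<open>p = y\<^sup>j\<close>: left multiplication by \<open>y\<close> takes monomials to multiples
  of monomials.
\<close>

lemma plane_class_comm_power:
  "plane_class q (gen GenY * (gen GenX ^ m * p)) = plane_class q (scal (q ^ m) * gen GenX ^ m * (gen GenY * p))"
proof (induction m)
  case 0
  show ?case by simp
next
  case (Suc m)
  have c: "gen GenX * scal (q ^ m) = scal (q ^ m) * gen GenX" by (rule scal_central)
  have "plane_class q (gen GenY * (gen GenX ^ Suc m * p)) =
      plane_class q (gen GenY * gen GenX * (gen GenX ^ m * p))"
    by (simp add: mult.assoc)
  also have "\<dots> = plane_class q (scal q * gen GenX * gen GenY * (gen GenX ^ m * p))"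
    by (rule plane_class_comm)
  also have "\<dots> = plane_class q (scal q * gen GenX) \<otimes>\<^bsub>presented_algebra (qplane_rels q)\<^esub>
      plane_class q (gen GenY * (gen GenX ^ m * p))"
    by (simp add: mult.assoc)
  also have "\<dots> = plane_class q (scal q * gen GenX * (scal (q ^ m) * gen GenX ^ m * (gen GenY * p)))"
    by (simp add: Suc)
  also have "scal q * gen GenX * (scal (q ^ m) * gen GenX ^ m * (gen GenY * p)) =
      scal q * (gen GenX * scal (q ^ m)) * gen GenX ^ m * (gen GenY * p)"
    by (simp only: mult.assoc)
  also have "\<dots> = (scal q * scal (q ^ m)) * gen GenX ^ Suc m * (gen GenY * p)"
    by (simp only: c mult.assoc power_Suc)
  also have "scal q * scal (q ^ m) = (scal (q ^ Suc m) :: qplane_gen free_alg)"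
    by (simp add: mult_single)
  finally show ?case .
qed

fun restrict_to_axis :: "qplane_gen \<Rightarrow> complex poly" where
  "restrict_to_axis GenX = [:0, 1:]"
| "restrict_to_axis GenY = 0"

interpretation poly_const: scalar_embedding "\<lambda>c. [:c:]"
  by unfold_locales auto

text \<open>
  The homomorphism to \<open>\<complex>[x]\<close> that sets \<open>y = 0\<close>; it respects the relation \<open>y x = q x y\<close>, both sides of
  which vanish.
\<close>

definition axis_poly :: "qplane_gen free_alg \<Rightarrow> complex poly" where
  "axis_poly = free_extension (\<lambda>c. [:c:]) restrict_to_axis"

lemma axis_poly_class:
  assumes "plane_class q p = plane_class q p'"
  shows "axis_poly p = axis_poly p'"
proof -
  have "free_extension (\<lambda>c. [:c:]) restrict_to_axis r = 0" if "r \<in> qplane_rels q" for r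
  proof -
    have r: "r + scal q * gen GenX * gen GenY = gen GenY * gen GenX"
      using that by (simp add: qplane_rels_def)
    have "free_extension (\<lambda>c. [:c:]) restrict_to_axis (r + scal q * gen GenX * gen GenY) = 0"
      unfolding r by (simp add: poly_const.free_extension_mult free_extension_gen)
    then show ?thesis
      by (simp add: poly_const.free_extension_add poly_const.free_extension_mult free_extension_gen)
  qed
  then show ?thesis
    unfolding axis_poly_def by (rule poly_const.free_extension_presented_class) (use assms in auto)
qed

lemma axis_poly_zero: "axis_poly 0 = 0"
  by (simp add: axis_poly_def poly_const.free_extension_zero)

lemma axis_poly_add: "axis_poly (p + p') = axis_poly p + axis_poly p'"
  by (simp add: axis_poly_def poly_const.free_extension_add)

lemma axis_poly_power_x: "axis_poly (scal c * gen GenX ^ n) = monom c n"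
proof -
  have "axis_poly (gen GenX ^ n) = monom 1 n"
    by (induction n)
      (simp_all add: axis_poly_def poly_const.free_extension_mult free_extension_gen
        poly_const.free_extension_single[of _ 0 1, simplified] zero_free_word_def monom_Suc)
  then show ?thesis
    by (simp add: axis_poly_def poly_const.free_extension_mult poly_const.free_extension_single
        zero_free_word_def smult_monom)
qed

section \<open>Module algebra structures on the quantum plane\<close>

text \<open>
  The values of \<open>k\<close> and \<open>f\<close> on the generators, together with the compatibility with products,
  determine \<open>f\<close> on all monomials.
\<close>

locale qplane_action =
  fixes q d0 :: complex
    and \<pi> :: "uq_gen free_alg set \<Rightarrow> qplane_gen free_alg set \<Rightarrow> qplane_gen free_alg set"
  assumes q_nonzero: "q \<noteq> 0"
    and q_not_root_of_unity: "\<And>n::nat. n > 0 \<Longrightarrow> q ^ n \<noteq> 1"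
    and d0_nonzero: "d0 \<noteq> 0"
    and module_algebra: "uq_module_algebra q (qplane q) \<pi>"
    and k_x: "\<pi> (uq_k q) (qplane_x q) = q \<odot>\<^bsub>qplane q\<^esub> qplane_x q"
    and k_y: "\<pi> (uq_k q) (qplane_y q) = q\<^sup>2 \<odot>\<^bsub>qplane q\<^esub> qplane_y q"
    and f_x: "\<pi> (uq_f q) (qplane_x q) = \<zero>\<^bsub>qplane q\<^esub>"
    and f_y: "\<pi> (uq_f q) (qplane_y q) = d0 \<odot>\<^bsub>qplane q\<^esub> \<one>\<^bsub>qplane q\<^esub>"
begin

abbreviation "A \<equiv> qplane q"
abbreviation "M \<equiv> rep_module A \<pi>"

sublocale A: ring A
  by (simp add: qplane_def ring_presented_algebra)

lemma carrier_A: "carrier A = range (plane_class q)"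
  by (simp add: qplane_def presented_carrier)

lemma M_simps [simp]: "carrier M = carrier A" "\<zero>\<^bsub>M\<^esub> = \<zero>\<^bsub>A\<^esub>" "u \<oplus>\<^bsub>M\<^esub> v = u \<oplus>\<^bsub>A\<^esub> v" "h \<odot>\<^bsub>M\<^esub> v = \<pi> h v"
  by (simp_all add: rep_module_def ring.defs module.defs)

lemma rep: "algebra_rep (uq q) A \<pi>"
  using module_algebra by (simp add: uq_module_algebra_def)

sublocale uq_module q M
proof -
  have "abelian_group M"
    by (rule abelian_group_transfer[OF A.abelian_group_axioms])
      (simp_all add: rep_module_def ring.defs module.defs)
  moreover have "left_module_axioms (uq q) M"
    using rep by unfold_locales (auto simp: algebra_rep_def linear_endo_def)
  ultimately show "uq_module q M"
    by (intro uq_module.intro left_module.intro ring_uq)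
qed

lemma act_closed_A [simp, intro]: "v \<in> carrier A \<Longrightarrow> act p v \<in> carrier A"
  using act_closed[of v p] by simp

lemma act_eq: "act p v = \<pi> (uq_class q p) v"
  by (simp add: act_def)

lemma scale_eq: "v \<in> carrier A \<Longrightarrow> scale c v = c \<odot>\<^bsub>A\<^esub> v"
proof -
  assume v: "v \<in> carrier A"
  have "uq_class q (scal c) = c \<odot>\<^bsub>uq q\<^esub> \<one>\<^bsub>uq q\<^esub>"
    by (simp add: uq_class_one uq_class_smult)
  moreover have "\<one>\<^bsub>uq q\<^esub> \<in> carrier (uq q)" by (simp add: uq_class_one)
  ultimately show ?thesis using rep v by (simp add: act_eq algebra_rep_def)
qed

lemma scale_class: "scale c (plane_class q p) = plane_class q (scal c * p)"
  by (simp add: scale_eq carrier_A) (simp add: qplane_def)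

lemma add_class: "plane_class q p \<oplus>\<^bsub>A\<^esub> plane_class q p' = plane_class q (p + p')"
  and mult_class: "plane_class q p \<otimes>\<^bsub>A\<^esub> plane_class q p' = plane_class q (p * p')"
  and one_class: "\<one>\<^bsub>A\<^esub> = plane_class q 1"
  and zero_class: "\<zero>\<^bsub>A\<^esub> = plane_class q 0"
  by (simp_all add: qplane_def presented_one presented_zero)

lemma scale_mult_left:
  assumes "u \<in> carrier A" "v \<in> carrier A"
  shows "scale c u \<otimes>\<^bsub>A\<^esub> v = scale c (u \<otimes>\<^bsub>A\<^esub> v)"
  using assms by (auto simp: carrier_A scale_class mult_class mult.assoc)

lemma scale_mult_right:
  assumes "u \<in> carrier A" "v \<in> carrier A"
  shows "u \<otimes>\<^bsub>A\<^esub> scale c v = scale c (u \<otimes>\<^bsub>A\<^esub> v)"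
proof -
  obtain p p' where "u = plane_class q p" "v = plane_class q p'" using assms by (auto simp: carrier_A)
  moreover have "p * (scal c * p') = scal c * (p * p')"
    by (simp only: mult.assoc[symmetric] scal_central)
  ultimately show ?thesis by (simp add: scale_class mult_class)
qed

lemma act_product:
  assumes "u \<in> carrier A" "v \<in> carrier A"
  shows "K (u \<otimes>\<^bsub>A\<^esub> v) = K u \<otimes>\<^bsub>A\<^esub> K v"
    and "F (u \<otimes>\<^bsub>A\<^esub> v) = F u \<otimes>\<^bsub>A\<^esub> v \<oplus>\<^bsub>A\<^esub> Kinv u \<otimes>\<^bsub>A\<^esub> F v"
proof -
  \<comment> \<open>On a generator the sum over the keys of the coproduct has one or two explicit terms.\<close>
  have comult: "uq_comult (gen g) = uq_comult_gen g" for g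
    unfolding uq_comult_def by (rule free_extension_gen) simp
  have MA: "act p (u \<otimes>\<^bsub>A\<^esub> v) = (\<Oplus>\<^bsub>A\<^esub>t\<in>Poly_Mapping.keys (uq_comult p).
      Poly_Mapping.lookup (uq_comult p) t \<odot>\<^bsub>A\<^esub>
        (act (Poly_Mapping.single (fst t) 1) u \<otimes>\<^bsub>A\<^esub> act (Poly_Mapping.single (snd t) 1) v))" for p
    using module_algebra assms by (simp add: uq_module_algebra_def act_eq)
  have cl: "act p u \<in> carrier A" "act p v \<in> carrier A" for p
    using act_closed assms by simp_all
  have one: "1 \<odot>\<^bsub>A\<^esub> a = a" if "a \<in> carrier A" for a
    using scale_eq[OF that, of 1] scale_one[of a] that by simp
  have empty: "act (Poly_Mapping.single (Word []) 1) a = a" if "a \<in> carrier A" for a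
    using act_one[of a] that by (metis M_simps(1) single_one zero_free_word_def)
  show "K (u \<otimes>\<^bsub>A\<^esub> v) = K u \<otimes>\<^bsub>A\<^esub> K v"
    using cl[of "gen GenK"] by (simp add: MA comult gen_def[symmetric] one)
  define a b where "a = (Word [GenF], Word [] :: uq_gen free_word)" and "b = (Word [GenKinv], Word [GenF])"
  have ab: "a \<noteq> b" by (simp add: a_def b_def)
  have "uq_comult (gen GenF) = Poly_Mapping.single a 1 + Poly_Mapping.single b 1"
    by (simp add: comult a_def b_def)
  moreover have "Poly_Mapping.keys (Poly_Mapping.single a (1::complex) + Poly_Mapping.single b 1) = {a, b}"
    using ab by (auto simp: in_keys_iff lookup_add lookup_single when_def split: if_splits)
  ultimately show "F (u \<otimes>\<^bsub>A\<^esub> v) = F u \<otimes>\<^bsub>A\<^esub> v \<oplus>\<^bsub>A\<^esub> Kinv u \<otimes>\<^bsub>A\<^esub> F v"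
    using ab cl assms
    by (simp add: MA lookup_add lookup_single when_def one)
      (simp add: a_def b_def gen_def[symmetric] empty)
qed

lemma act_unit: "K \<one>\<^bsub>A\<^esub> = \<one>\<^bsub>A\<^esub>" "E \<one>\<^bsub>A\<^esub> = \<zero>\<^bsub>A\<^esub>" "F \<one>\<^bsub>A\<^esub> = \<zero>\<^bsub>A\<^esub>"
proof -
  have counit: "uq_counit (gen g) = uq_counit_gen g" for g
    unfolding uq_counit_def by (rule free_extension_gen) simp
  have "act (gen g) \<one>\<^bsub>A\<^esub> = scale (uq_counit_gen g) \<one>\<^bsub>A\<^esub>" for g
    using module_algebra by (simp add: uq_module_algebra_def act_eq[of "gen g"] counit scale_eq)
  from this[of GenK] this[of GenE] this[of GenF]
  show "K \<one>\<^bsub>A\<^esub> = \<one>\<^bsub>A\<^esub>" "E \<one>\<^bsub>A\<^esub> = \<zero>\<^bsub>A\<^esub>" "F \<one>\<^bsub>A\<^esub> = \<zero>\<^bsub>A\<^esub>"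
    by simp_all
qed

abbreviation "X \<equiv> plane_class q (gen GenX)"
abbreviation "Y \<equiv> plane_class q (gen GenY)"

lemma plane_class_closed [simp, intro]: "plane_class q p \<in> carrier A"
  by (simp add: carrier_A)

lemma action_XY: "K X = scale q X" "K Y = scale (q\<^sup>2) Y" "F X = \<zero>\<^bsub>A\<^esub>" "F Y = scale d0 \<one>\<^bsub>A\<^esub>"
  using k_x k_y f_x f_y
  by (simp_all add: act_eq[of "gen _"] scale_eq uq_k_def uq_f_def qplane_x_def qplane_y_def)

subsection \<open>Monomials\<close>

definition monomial :: "nat \<Rightarrow> nat \<Rightarrow> qplane_gen free_alg set" where
  "monomial m j = X [^]\<^bsub>A\<^esub> m \<otimes>\<^bsub>A\<^esub> Y [^]\<^bsub>A\<^esub> j"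

lemma K_X_pow: "K (X [^]\<^bsub>A\<^esub> (m::nat)) = scale (q ^ m) (X [^]\<^bsub>A\<^esub> m)"
proof (induction m)
  case (Suc m)
  then show ?case
    using scale_scale[of "X [^]\<^bsub>A\<^esub> Suc m" q "q ^ m"]
    by (simp add: act_product action_XY scale_mult_left scale_mult_right mult.commute)
qed (simp add: act_unit)

lemma F_X_pow: "F (X [^]\<^bsub>A\<^esub> (m::nat)) = \<zero>\<^bsub>A\<^esub>"
proof (induction m)
  case (Suc m)
  then show ?case using act_closed[of "X [^]\<^bsub>A\<^esub> m"] by (simp add: act_product action_XY)
qed (simp add: act_unit)

lemma F_Y_pow: "F (Y [^]\<^bsub>A\<^esub> Suc j) = scale (d0 * (\<Sum>i\<le>j. inverse (q\<^sup>2) ^ i)) (Y [^]\<^bsub>A\<^esub> j)"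
proof (induction j)
  case 0
  then show ?case by (simp add: action_XY)
next
  case (Suc j)
  have Kinv: "Kinv Y = scale (inverse (q\<^sup>2)) Y"
    by (rule Kinv_eigen) (simp_all add: action_XY q_nonzero)
  have "F (Y [^]\<^bsub>A\<^esub> Suc (Suc j)) = F (Y \<otimes>\<^bsub>A\<^esub> Y [^]\<^bsub>A\<^esub> Suc j)"
    by (simp only: A.nat_pow_Suc2 plane_class_closed)
  also have "\<dots> = scale d0 \<one>\<^bsub>A\<^esub> \<otimes>\<^bsub>A\<^esub> Y [^]\<^bsub>A\<^esub> Suc j \<oplus>\<^bsub>A\<^esub>
      scale (inverse (q\<^sup>2)) Y \<otimes>\<^bsub>A\<^esub> scale (d0 * (\<Sum>i\<le>j. inverse (q\<^sup>2) ^ i)) (Y [^]\<^bsub>A\<^esub> j)"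
    using Suc by (simp add: act_product(2) Kinv action_XY del: A.nat_pow_Suc)
  also have "\<dots> = scale d0 (Y [^]\<^bsub>A\<^esub> Suc j) \<oplus>\<^bsub>A\<^esub>
      scale (inverse (q\<^sup>2) * (d0 * (\<Sum>i\<le>j. inverse (q\<^sup>2) ^ i))) (Y [^]\<^bsub>A\<^esub> Suc j)"
    using act_closed[of Y] act_closed[of "Y [^]\<^bsub>A\<^esub> j"]
    by (simp add: scale_mult_left scale_mult_right A.nat_pow_Suc2[symmetric] mult_ac del: A.nat_pow_Suc)
  also have "\<dots> = scale (d0 + inverse (q\<^sup>2) * (d0 * (\<Sum>i\<le>j. inverse (q\<^sup>2) ^ i))) (Y [^]\<^bsub>A\<^esub> Suc j)"
    using scale_add_left[of "Y [^]\<^bsub>A\<^esub> Suc j"] by (simp del: A.nat_pow_Suc)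
  also have "d0 + inverse (q\<^sup>2) * (d0 * (\<Sum>i\<le>j. inverse (q\<^sup>2) ^ i)) = d0 * (\<Sum>i\<le>Suc j. inverse (q\<^sup>2) ^ i)"
    by (simp only: sum.atMost_Suc_shift power_0 power_Suc sum_distrib_left distrib_left mult_1_left mult_1_right mult_ac)
  finally show ?case .
qed

definition monomial_coeff :: "nat \<Rightarrow> nat \<Rightarrow> complex" where
  "monomial_coeff m j = inverse (q ^ m) * (d0 * (\<Sum>i\<le>j. inverse (q\<^sup>2) ^ i))"

text \<open>
  The sum is a geometric progression with ratio \<open>q\<^bsup>-2\<^esup>\<close>, which is not a root of unity.
\<close>

lemma monomial_coeff_nonzero: "monomial_coeff m j \<noteq> 0"
proof -
  have "inverse (q\<^sup>2) ^ Suc j \<noteq> 1"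
    using q_not_root_of_unity[of "2 * Suc j"] power_mult[of q 2 "Suc j"]
    by (simp add: power_inverse del: power_Suc mult_Suc_right)
  then have "(\<Sum>i\<le>j. inverse (q\<^sup>2) ^ i) \<noteq> 0"
    using sum_gp_basic[of "inverse (q\<^sup>2)" j] by auto
  then show ?thesis using d0_nonzero q_nonzero by (simp add: monomial_coeff_def)
qed

lemma monomial_zero: "monomial m 0 = X [^]\<^bsub>A\<^esub> m"
  by (simp add: monomial_def)

lemma monomial_closed [simp, intro]: "monomial m j \<in> carrier A"
  by (simp add: monomial_def)

lemma F_monomial_Suc: "F (monomial m (Suc j)) = scale (monomial_coeff m j) (monomial m j)"
proof -
  define Z where "Z = Y [^]\<^bsub>A\<^esub> Suc j"
  have Z: "Z \<in> carrier A" "F Z = scale (d0 * (\<Sum>i\<le>j. inverse (q\<^sup>2) ^ i)) (Y [^]\<^bsub>A\<^esub> j)"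
    by (simp_all only: Z_def F_Y_pow A.nat_pow_closed plane_class_closed)
  have "Kinv (X [^]\<^bsub>A\<^esub> m) = scale (inverse (q ^ m)) (X [^]\<^bsub>A\<^esub> m)"
    by (rule Kinv_eigen) (simp_all add: K_X_pow q_nonzero)
  then show ?thesis
    unfolding monomial_def Z_def[symmetric] using Z
    by (simp add: monomial_coeff_def act_product F_X_pow scale_mult_left scale_mult_right mult_ac)
qed

lemma monomial_class: "monomial m j = plane_class q (gen GenX ^ m * gen GenY ^ j)"
  by (simp add: monomial_def qplane_def)

lemma X_pow_class: "scale a (X [^]\<^bsub>A\<^esub> (n::nat)) = plane_class q (scal a * gen GenX ^ n)"
  using scale_class[of a "gen GenX ^ n"] by (simp add: qplane_def)

lemma X_pow_independent:
  fixes n :: nat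
  assumes "finite S" "(\<Oplus>\<^bsub>M\<^esub>n\<in>S. scale (a n) (X [^]\<^bsub>A\<^esub> n)) = \<zero>\<^bsub>M\<^esub>" "n \<in> S"
  shows "a n = 0"
proof -
  have "(\<Oplus>\<^bsub>M\<^esub>n\<in>S. scale (a n) (X [^]\<^bsub>A\<^esub> n)) = plane_class q (\<Sum>n\<in>S. scal (a n) * gen GenX ^ n)"
    using assms(1)
  proof induction
    case (insert n S)
    have "(\<lambda>n. scale (a n) (X [^]\<^bsub>A\<^esub> n)) \<in> S \<rightarrow> carrier M" "scale (a n) (X [^]\<^bsub>A\<^esub> n) \<in> carrier M"
      using act_closed by simp_all
    then have "(\<Oplus>\<^bsub>M\<^esub>n\<in>insert n S. scale (a n) (X [^]\<^bsub>A\<^esub> n)) =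
        scale (a n) (X [^]\<^bsub>A\<^esub> n) \<oplus>\<^bsub>M\<^esub> (\<Oplus>\<^bsub>M\<^esub>n\<in>S. scale (a n) (X [^]\<^bsub>A\<^esub> n))"
      using insert.hyps by (intro finsum_insert)
    then show ?case using insert by (simp add: X_pow_class add_class)
  qed (simp add: zero_class)
  then have "axis_poly (\<Sum>n\<in>S. scal (a n) * gen GenX ^ n) = 0"
    using assms(2) axis_poly_class[of q _ 0] by (simp add: zero_class axis_poly_zero)
  moreover have "axis_poly (\<Sum>n\<in>S. scal (a n) * gen GenX ^ n) = (\<Sum>n\<in>S. monom (a n) n)"
    using assms(1) by induction (simp_all add: axis_poly_zero axis_poly_add axis_poly_power_x)
  ultimately have "coeff (\<Sum>n\<in>S. monom (a n) n) n = 0" by simp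
  then show ?thesis using assms by (simp add: coeff_sum)
qed

lemma X_pow_nonzero: "X [^]\<^bsub>A\<^esub> (n::nat) \<noteq> \<zero>\<^bsub>A\<^esub>"
proof
  assume "X [^]\<^bsub>A\<^esub> n = \<zero>\<^bsub>A\<^esub>"
  then have "(\<Oplus>\<^bsub>M\<^esub>n\<in>{n}. scale 1 (X [^]\<^bsub>A\<^esub> n)) = \<zero>\<^bsub>M\<^esub>" by simp
  then show False using X_pow_independent[of "{n}" "\<lambda>_. 1" n] by simp
qed

lemma ladder_familyI:
  assumes "\<And>n. lowering_ladder q M (w n) (c n)" "\<And>n. w n 0 = X [^]\<^bsub>A\<^esub> n"
  shows "ladder_family q M w c"
  using assms X_pow_independent
  by (intro ladder_family.intro ladder_family_axioms.intro uq_module_axioms) auto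

lemma monomial_family: "ladder_family q M monomial monomial_coeff"
proof (rule ladder_familyI)
  show "lowering_ladder q M (monomial n) (monomial_coeff n)" for n
    by (intro lowering_ladder.intro lowering_ladder_axioms.intro uq_module_axioms)
      (simp_all add: monomial_zero F_X_pow F_monomial_Suc monomial_coeff_nonzero X_pow_nonzero)
qed (rule monomial_zero)

lemma X_mult_monomial: "X \<otimes>\<^bsub>A\<^esub> monomial m j = monomial (Suc m) j"
  by (simp only: monomial_def A.nat_pow_Suc2 plane_class_closed A.m_assoc A.nat_pow_closed)

lemma Y_mult_monomial: "Y \<otimes>\<^bsub>A\<^esub> monomial m j = scale (q ^ m) (monomial m (Suc j))"
  by (simp only: monomial_class scale_class mult_class plane_class_comm_power mult.assoc power_Suc)

text \<open>
  The sum of the ladders of monomials contains \<open>1\<close> and is stable under left multiplication by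
  \<open>x\<close> and \<open>y\<close>.
\<close>

lemma monomials_span: "ladder_family.total_span q M monomial = carrier A"
proof -
  interpret B: ladder_family q M monomial monomial_coeff by (rule monomial_family)
  have mult: "plane_class q (gen g) \<otimes>\<^bsub>A\<^esub> u \<in> B.total_span" if "u \<in> B.total_span" for g u
  proof (rule B.total_span_linear[OF _ _ _ _ that])
    have "monomial m j \<in> B.total_span" for m j
      using B.total_spanI[OF seq_span_basis[of "monomial m" j]] by simp
    then show "plane_class q (gen g) \<otimes>\<^bsub>A\<^esub> monomial m j \<in> B.total_span" for m j
      using B.total_span_scale by (cases g) (auto simp: X_mult_monomial Y_mult_monomial)
  qed (simp_all add: A.r_distr scale_mult_right)
  have "plane_class q p \<in> B.total_span" for p
  proof (induction p rule: free_alg_induct)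
    case zero
    show ?case using B.total_spanI[OF seq_span_zero] by (simp add: zero_class)
  next
    case one
    have "monomial 0 0 = plane_class q 1" by (simp add: monomial_zero one_class)
    then show ?case using B.total_spanI[OF seq_span_basis[of "monomial 0" 0]] by simp
  next
    case (add p p')
    then show ?case using B.total_span_add[of "plane_class q p" "plane_class q p'"] by (simp add: add_class)
  next
    case (scal c p)
    then show ?case using B.total_span_scale[of "plane_class q p" c] by (simp add: scale_class)
  next
    case (gen g p)
    then show ?case using mult[of "plane_class q p" g] by (simp add: mult_class)
  qed
  then show ?thesis using B.total_span_closed by (auto simp: carrier_A)
qed

lemma F_nilpotent: "u \<in> carrier A \<Longrightarrow> \<exists>n. (F ^^ n) u = \<zero>\<^bsub>A\<^esub>"
  using ladder_family.total_span_nilpotent[OF monomial_family, of u] monomials_span by simp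

lemma F_kernel:
  assumes "u \<in> carrier A" "F u = \<zero>\<^bsub>A\<^esub>"
  shows "\<exists>S a. finite S \<and> u = (\<Oplus>\<^bsub>M\<^esub>n\<in>S. scale (a n) (X [^]\<^bsub>A\<^esub> (n::nat)))"
  using ladder_family.total_span_kernel[OF monomial_family, of u] monomials_span assms
  by (simp add: monomial_zero)

end

section \<open>The decomposition of the quantum plane\<close>

context qplane_action
begin

text \<open>
  The zeroth ladder starts with \<open>1\<close> and continues with the vectors \<open>e\<^sup>j y\<close>, because \<open>e\<close> kills \<open>1\<close>.
\<close>

definition plane_ladder :: "nat \<Rightarrow> nat \<Rightarrow> qplane_gen free_alg set" where
  "plane_ladder n i =
     (if n > 0 then (E ^^ i) (X [^]\<^bsub>A\<^esub> n)
      else case i of 0 \<Rightarrow> \<one>\<^bsub>A\<^esub> | Suc j \<Rightarrow> (E ^^ j) Y)"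

abbreviation "V n \<equiv> seq_span (plane_ladder n)"

lemma generic: "n \<ge> 1 \<Longrightarrow> lowering_coeff q (q ^ n) i \<noteq> 0"
  using lowering_coeff_nonzero[OF q_nonzero q_not_root_of_unity] .

lemma X_lowest_weight:
  assumes "n \<ge> 1"
  shows "lowest_weight q M (q ^ n) (X [^]\<^bsub>A\<^esub> n)"
  using assms
  by (intro lowest_weight.intro weight_vector.intro weight_vector_axioms.intro
      lowest_weight_axioms.intro uq_module_axioms)
    (simp_all add: q_nonzero K_X_pow F_X_pow X_pow_nonzero generic act_zero_right[simplified])

lemma Y_weight_vector: "weight_vector q M (q\<^sup>2) Y"
  by (intro weight_vector.intro weight_vector_axioms.intro uq_module_axioms)
    (simp_all add: q_nonzero action_XY act_unit act_zero_right[simplified])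

lemma plane_ladder_pos: "n \<ge> 1 \<Longrightarrow> plane_ladder n = (\<lambda>i. (E ^^ i) (X [^]\<^bsub>A\<^esub> n))"
  by (auto simp: plane_ladder_def fun_eq_iff)

lemma plane_ladder_zero: "plane_ladder 0 0 = \<one>\<^bsub>A\<^esub>" "plane_ladder 0 (Suc j) = (E ^^ j) Y"
  by (simp_all add: plane_ladder_def)

lemma plane_ladder_bottom: "plane_ladder n 0 = X [^]\<^bsub>A\<^esub> n"
  by (simp add: plane_ladder_def)

lemma one_nonzero: "\<one>\<^bsub>A\<^esub> \<noteq> \<zero>\<^bsub>A\<^esub>"
  using X_pow_nonzero[of 0] by simp

lemma zero_ladder:
  "lowering_ladder q M (plane_ladder 0) (\<lambda>i. case i of 0 \<Rightarrow> d0 | Suc j \<Rightarrow> lowering_coeff q (q\<^sup>2) j)"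
proof (intro lowering_ladder.intro lowering_ladder_axioms.intro uq_module_axioms)
  fix i
  show "plane_ladder 0 i \<in> carrier M"
    using act_funpow_closed[of Y] by (cases i) (simp_all add: plane_ladder_zero)
  show "F (plane_ladder 0 (Suc i)) = scale (case i of 0 \<Rightarrow> d0 | Suc j \<Rightarrow> lowering_coeff q (q\<^sup>2) j) (plane_ladder 0 i)"
  proof (cases i)
    case (Suc j)
    then show ?thesis
      using weight_vector.F_raised_Suc[OF Y_weight_vector, of j] by (simp add: plane_ladder_zero)
  qed (simp add: plane_ladder_zero action_XY)
  show "(case i of 0 \<Rightarrow> d0 | Suc j \<Rightarrow> lowering_coeff q (q\<^sup>2) j) \<noteq> 0"
    using d0_nonzero generic[of 2] by (simp split: nat.split)
qed (simp_all add: plane_ladder_zero act_unit one_nonzero)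

lemma plane_family: "\<exists>c. ladder_family q M plane_ladder c"
proof -
  have "\<exists>c. lowering_ladder q M (plane_ladder n) c" for n
  proof (cases "n \<ge> 1")
    case True
    interpret lowest_weight q M "q ^ n" "X [^]\<^bsub>A\<^esub> n" using True by (rule X_lowest_weight)
    show ?thesis using lowering_ladder_axioms True by (auto simp: plane_ladder_pos)
  next
    case False
    then have "n = 0" by simp
    then show ?thesis using zero_ladder by blast
  qed
  then obtain c where "\<And>n. lowering_ladder q M (plane_ladder n) (c n)" by metis
  then show ?thesis using ladder_familyI plane_ladder_bottom by blast
qed

lemma Kinv_unit: "Kinv \<one>\<^bsub>A\<^esub> = \<one>\<^bsub>A\<^esub>"
  using Kinv_K[of "\<one>\<^bsub>A\<^esub>"] by (simp add: act_unit)

lemma act_gen_unit: "\<exists>c. act (gen g) \<one>\<^bsub>A\<^esub> = scale c \<one>\<^bsub>A\<^esub>"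
proof (cases "g = GenK \<or> g = GenKinv")
  case True
  then show ?thesis by (intro exI[of _ 1]) (auto simp: act_unit Kinv_unit)
next
  case False
  then have "act (gen g) \<one>\<^bsub>A\<^esub> = scale 0 \<one>\<^bsub>A\<^esub>" by (cases g) (auto simp: act_unit)
  then show ?thesis ..
qed

lemma plane_ladder_closed [simp, intro]: "plane_ladder n i \<in> carrier A"
  using plane_family ladder_family.w_closed M_simps(1) by blast

lemma plane_ladder_in_V: "plane_ladder n i \<in> V n"
  by (rule seq_span_basis) simp

lemma unit_in_V0: "\<one>\<^bsub>A\<^esub> \<in> V 0" and raised_in_V0: "(E ^^ j) Y \<in> V 0"
  using plane_ladder_in_V[of 0 0] plane_ladder_in_V[of 0 "Suc j"]
  by (simp_all add: plane_ladder_zero)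

lemma V0_submodule: "submodule (V 0) (uq q) M"
proof (rule submodule_generatorsI)
  interpret Y: weight_vector q M "q\<^sup>2" Y by (rule Y_weight_vector)
  fix g v assume v: "v \<in> V 0"
  show "act (gen g) v \<in> V 0"
  proof (rule seq_span_act[OF _ _ v])
    fix i
    show "act (gen g) (plane_ladder 0 i) \<in> V 0"
    proof (cases i)
      case 0
      then show ?thesis
        using act_gen_unit[of g] seq_span_scale[of "plane_ladder 0", OF _ unit_in_V0] by (auto simp: plane_ladder_zero)
    next
      case (Suc j)
      have "F ((E ^^ j) Y) \<in> V 0"
        using lowering_ladder.F_seq_span[OF zero_ladder raised_in_V0] .
      moreover have "E ((E ^^ j) Y) \<in> V 0" using raised_in_V0[of "Suc j"] by simp
      moreover have "scale a ((E ^^ j) Y) \<in> V 0" for a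
        using raised_in_V0 seq_span_scale[of "plane_ladder 0"] by simp
      ultimately show ?thesis
        by (cases g) (simp_all add: Suc plane_ladder_zero Y.K_raised Y.Kinv_raised)
    qed
  qed simp
qed (use seq_span_subset[of "plane_ladder 0"] seq_span_zero[of "plane_ladder 0"]
    seq_span_add[of "plane_ladder 0"] seq_span_scale[of "plane_ladder 0"] in auto)

lemma V_submodule: "submodule (V n) (uq q) M"
proof (cases "n \<ge> 1")
  case True
  interpret lowest_weight q M "q ^ n" "X [^]\<^bsub>A\<^esub> n" using True by (rule X_lowest_weight)
  show ?thesis using raised_span_submodule True by (simp add: plane_ladder_pos)
next
  case False
  then have "n = 0" by simp
  then show ?thesis using V0_submodule by simp
qed

lemma plane_direct_sum: "internal_direct_sum (uq q) M V"
proof -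
  obtain c where "ladder_family q M plane_ladder c" using plane_family ..
  then interpret B: ladder_family q M plane_ladder c .
  have "B.total_span = carrier M"
  proof (rule B.total_span_eq_carrier)
    show "\<exists>n. (F ^^ n) u = \<zero>\<^bsub>M\<^esub>" if "u \<in> carrier M" for u
      using F_nilpotent that by simp
    fix u assume "u \<in> carrier M" "F u = \<zero>\<^bsub>M\<^esub>"
    then obtain S and a :: "nat \<Rightarrow> complex" where
      "finite S" "u = (\<Oplus>\<^bsub>M\<^esub>n\<in>S. scale (a n) (plane_ladder n 0))"
      using F_kernel[of u] by (auto simp: plane_ladder_bottom)
    moreover have "scale (a n) (plane_ladder n 0) \<in> V n" for n
      by (intro seq_span_scale seq_span_basis) simp_all
    ultimately show "u \<in> B.total_span" by (auto simp: B.total_span_def)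
  qed
  then show ?thesis by (rule B.internal_direct_sum_spans[OF V_submodule])
qed

lemma V_lowest_weight_vector:
  "lowest_weight_vector q (M\<lparr>carrier := V n\<rparr>) (q ^ n) (X [^]\<^bsub>A\<^esub> n)"
proof -
  have "X [^]\<^bsub>A\<^esub> n \<in> V n"
    using plane_ladder_in_V[of n 0] by (simp add: plane_ladder_bottom)
  moreover have "\<pi> (q ^ n \<odot>\<^bsub>uq q\<^esub> \<one>\<^bsub>uq q\<^esub>) (X [^]\<^bsub>A\<^esub> n) = scale (q ^ n) (X [^]\<^bsub>A\<^esub> n)"
    by (simp add: uq_class_one uq_class_smult act_eq)
  ultimately show ?thesis
    using K_X_pow[of n] F_X_pow[of n]
    by (simp add: lowest_weight_vector_def X_pow_nonzero act_eq uq_f_def uq_k_def)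
qed

lemma V_cyclic:
  assumes "n \<ge> 1"
  shows "cyclic_lowest_weight q (M\<lparr>carrier := V n\<rparr>) (q ^ n) (X [^]\<^bsub>A\<^esub> n)"
    and "V n = generated_submodule (uq q) M {X [^]\<^bsub>A\<^esub> n}"
proof -
  interpret lowest_weight q M "q ^ n" "X [^]\<^bsub>A\<^esub> n" using assms by (rule X_lowest_weight)
  show "cyclic_lowest_weight q (M\<lparr>carrier := V n\<rparr>) (q ^ n) (X [^]\<^bsub>A\<^esub> n)"
    "V n = generated_submodule (uq q) M {X [^]\<^bsub>A\<^esub> n}"
    using restrict_raised_span raised_span_eq_generated assms by (simp_all add: plane_ladder_pos)
qed

subsection \<open>The summand containing the constants\<close>

definition J0 :: "qplane_gen free_alg set set" where
  "J0 = range (\<lambda>c. scale c \<one>\<^bsub>A\<^esub>)"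

abbreviation "M0 \<equiv> M\<lparr>carrier := V 0\<rparr>"

sublocale M0: uq_module q M0
  by (rule restrict_uq_module[OF V0_submodule])

lemma M0_act [simp]: "M0.act p v = act p v"
  by (rule restrict_act[OF V0_submodule])

lemma J0_submodule: "submodule J0 (uq q) M0"
proof (rule submodule_restrict[OF _ V0_submodule])
  show "J0 \<subseteq> V 0"
    using unit_in_V0 submodule_act[OF V0_submodule] by (auto simp: J0_def)
  show "submodule J0 (uq q) M"
  proof (rule submodule_generatorsI)
    show "\<zero>\<^bsub>M\<^esub> \<in> J0" unfolding J0_def by (rule range_eqI[of _ _ 0]) simp
    show "u \<oplus>\<^bsub>M\<^esub> v \<in> J0" if "u \<in> J0" "v \<in> J0" for u v
      using that scale_add_left[of "\<one>\<^bsub>A\<^esub>"] unfolding J0_def by (auto simp del: act_closed_A)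
    show sc: "scale c v \<in> J0" if "v \<in> J0" for c v
      using that by (auto simp: J0_def)
    show "act (gen g) v \<in> J0" if v: "v \<in> J0" for g v
    proof -
      obtain c where "v = scale c \<one>\<^bsub>A\<^esub>" using v by (auto simp: J0_def)
      moreover obtain d where "act (gen g) \<one>\<^bsub>A\<^esub> = scale d \<one>\<^bsub>A\<^esub>" using act_gen_unit by blast
      ultimately show ?thesis by (simp add: J0_def)
    qed
  qed (auto simp: J0_def)
qed

lemma F_J0: "u \<in> J0 \<Longrightarrow> F u = \<zero>\<^bsub>A\<^esub>"
  using act_zero_right by (auto simp: J0_def act_unit)

lemma F_Y_nonzero: "F Y \<noteq> \<zero>\<^bsub>A\<^esub>"
  using scale_eq_zero_iff[of "\<one>\<^bsub>A\<^esub>" d0] by (simp add: action_XY d0_nonzero one_nonzero)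

text \<open>
  For a complement \<open>W\<close> the \<open>W\<close>-component \<open>w\<close> of \<open>y\<close> satisfies \<open>f w = f y = d0\<close>, a nonzero element of both
  \<open>J0\<close> and \<open>W\<close>.
\<close>

lemma J0_not_direct_summand: "\<not> direct_summand (uq q) M0 J0"
proof
  assume "direct_summand (uq q) M0 J0"
  then obtain W where W: "submodule W (uq q) M0" "J0 \<inter> W = {\<zero>\<^bsub>A\<^esub>}" "J0 <+>\<^bsub>M0\<^esub> W = V 0"
    by (auto simp: direct_summand_def)
  have "Y \<in> V 0" using raised_in_V0[of 0] by simp
  then obtain u w where uw: "u \<in> J0" "w \<in> W" "Y = u \<oplus>\<^bsub>A\<^esub> w"
    using W(3)[symmetric] by (auto simp: set_add_def')
  have "u \<in> carrier A" "w \<in> carrier A"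
    using uw J0_submodule W(1) M0.submoduleD(1) seq_span_subset[of "plane_ladder 0"] by auto
  then have "F Y = F w" using uw F_J0 act_add[of u w] by simp
  moreover have "F w \<in> W" using M0.submodule_act[OF W(1) uw(2), of "gen GenF"] by simp
  moreover have "F Y \<in> J0" by (auto simp: J0_def action_XY)
  ultimately show False using W(2) F_Y_nonzero by auto
qed

abbreviation "M0_quotient \<equiv> quotient_module M0 J0"

text \<open>
  Modulo constants \<open>f y = d0\<close> vanishes, so the class of \<open>y\<close> becomes a lowest weight vector, and the
  ladder \<open>1, y, e y, \<dots>\<close> loses its first member.
\<close>

lemma quotient_cyclic: "cyclic_lowest_weight q M0_quotient (q\<^sup>2) (J0 +>\<^bsub>M0\<^esub> Y)"
proof -
  interpret Q: uq_module q M0_quotient by (rule M0.quotient_uq_module[OF J0_submodule])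
  have Y0: "Y \<in> carrier M0" using raised_in_V0[of 0] by simp
  have Qact: "Q.act p (J0 +>\<^bsub>M0\<^esub> v) = J0 +>\<^bsub>M0\<^esub> act p v" if "v \<in> V 0" for p v
    using M0.quotient_act[OF J0_submodule, of v p] that by simp
  have zero: "J0 +>\<^bsub>M0\<^esub> v = \<zero>\<^bsub>M0_quotient\<^esub> \<longleftrightarrow> v \<in> J0" if "v \<in> V 0" for v
    using M0.quotient_class_zero[OF J0_submodule, of v] that by (simp add: M0.quotient_zero)
  have FY: "Q.F (J0 +>\<^bsub>M0\<^esub> Y) = \<zero>\<^bsub>M0_quotient\<^esub>"
  proof -
    have "F Y \<in> J0" by (auto simp: J0_def action_XY)
    moreover have "F Y \<in> V 0" using M0.act_closed[OF Y0, of "gen GenF"] by simp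
    ultimately show ?thesis using Qact Y0 zero by simp
  qed
  have "carrier M0_quotient = range (\<lambda>p. Q.act p (J0 +>\<^bsub>M0\<^esub> Y))"
  proof
    define R where "R = range (\<lambda>p. Q.act p (J0 +>\<^bsub>M0\<^esub> Y))"
    have Yq: "J0 +>\<^bsub>M0\<^esub> Y \<in> carrier M0_quotient"
      using Y0 by (auto simp: M0.quotient_carrier)
    then show "range (\<lambda>p. Q.act p (J0 +>\<^bsub>M0\<^esub> Y)) \<subseteq> carrier M0_quotient" by auto
    have R: "submodule R (uq q) M0_quotient" unfolding R_def using Yq by (rule Q.cyclic_submodule)
    have "V 0 \<subseteq> {v \<in> V 0. J0 +>\<^bsub>M0\<^esub> v \<in> R}"
    proof (rule seq_span_induct)
      show "\<zero>\<^bsub>M\<^esub> \<in> {v \<in> V 0. J0 +>\<^bsub>M0\<^esub> v \<in> R}"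
        using zero[of "\<zero>\<^bsub>A\<^esub>"] Q.submoduleD(2)[OF R] M0.submoduleD(2)[OF J0_submodule]
          M0.zero_closed by simp
      show "u \<oplus>\<^bsub>M\<^esub> v \<in> {v \<in> V 0. J0 +>\<^bsub>M0\<^esub> v \<in> R}"
        if "u \<in> {v \<in> V 0. J0 +>\<^bsub>M0\<^esub> v \<in> R}" "v \<in> {v \<in> V 0. J0 +>\<^bsub>M0\<^esub> v \<in> R}" for u v
        using that Q.submoduleD(3)[OF R, of "J0 +>\<^bsub>M0\<^esub> u" "J0 +>\<^bsub>M0\<^esub> v"]
          M0.quotient_add[OF J0_submodule, of u v] M0.a_closed[of u v] by simp
      show "scale c u \<in> {v \<in> V 0. J0 +>\<^bsub>M0\<^esub> v \<in> R}" if "u \<in> {v \<in> V 0. J0 +>\<^bsub>M0\<^esub> v \<in> R}" for c u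
        using that Q.submodule_act[OF R, of "J0 +>\<^bsub>M0\<^esub> u" "scal c"] Qact[of u] M0.act_closed[of u "scal c"] by auto
      show "plane_ladder 0 i \<in> {v \<in> V 0. J0 +>\<^bsub>M0\<^esub> v \<in> R}" for i
      proof (cases i)
        case 0
        have "\<one>\<^bsub>A\<^esub> \<in> J0" unfolding J0_def by (rule range_eqI[of _ _ 1]) simp
        then show ?thesis
          using 0 zero[OF unit_in_V0] Q.submoduleD(2)[OF R] unit_in_V0 by (simp add: plane_ladder_zero)
      next
        case (Suc j)
        have "J0 +>\<^bsub>M0\<^esub> (E ^^ j) Y = Q.act (gen GenE ^ j) (J0 +>\<^bsub>M0\<^esub> Y)"
          using Qact[of Y] Y0 act_power[of Y "gen GenE" j] by simp
        then show ?thesis using Suc raised_in_V0 by (auto simp: plane_ladder_zero R_def)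
      qed
    qed simp
    then show "carrier M0_quotient \<subseteq> range (\<lambda>p. Q.act p (J0 +>\<^bsub>M0\<^esub> Y))"
      unfolding R_def[symmetric] by (auto simp: M0.quotient_carrier)
  qed
  moreover have "J0 +>\<^bsub>M0\<^esub> Y \<noteq> \<zero>\<^bsub>M0_quotient\<^esub>"
    using zero[of Y] Y0 F_J0[of Y] F_Y_nonzero by auto
  moreover have "Q.K (J0 +>\<^bsub>M0\<^esub> Y) = Q.scale (q\<^sup>2) (J0 +>\<^bsub>M0\<^esub> Y)"
    using Qact[of Y] Y0 by (simp add: action_XY)
  moreover have "J0 +>\<^bsub>M0\<^esub> Y \<in> carrier M0_quotient"
    using Y0 by (auto simp: M0.quotient_carrier)
  ultimately show ?thesis
    using FY generic[of 2] q_nonzero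
    by (intro cyclic_lowest_weight.intro lowest_weight.intro weight_vector.intro Q.uq_module_axioms
        weight_vector_axioms.intro lowest_weight_axioms.intro cyclic_lowest_weight_axioms.intro) auto
qed

text \<open>
  The scalars act transitively on the nonzero constants.
\<close>

lemma J0_simple: "simple_module (uq q) (quotient_module (M0\<lparr>carrier := J0\<rparr>) {\<zero>\<^bsub>A\<^esub>})"
proof -
  define P where "P = M0\<lparr>carrier := J0\<rparr>"
  interpret P: uq_module q P unfolding P_def by (rule M0.restrict_uq_module[OF J0_submodule])
  have P: "carrier P = J0" "\<zero>\<^bsub>P\<^esub> = \<zero>\<^bsub>A\<^esub>" "h \<odot>\<^bsub>P\<^esub> v = \<pi> h v" for h v
    by (simp_all add: P_def)
  have Z: "submodule {\<zero>\<^bsub>A\<^esub>} (uq q) P" using P.zero_submodule by (simp add: P)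
  interpret Q: uq_module q "quotient_module P {\<zero>\<^bsub>A\<^esub>}" by (rule P.quotient_uq_module[OF Z])
  have one: "\<one>\<^bsub>A\<^esub> \<in> J0" unfolding J0_def by (rule range_eqI[of _ _ 1]) simp
  have zero: "{\<zero>\<^bsub>A\<^esub>} +>\<^bsub>P\<^esub> v = \<zero>\<^bsub>quotient_module P {\<zero>\<^bsub>A\<^esub>}\<^esub> \<longleftrightarrow> v = \<zero>\<^bsub>A\<^esub>" if "v \<in> J0" for v
    using P.quotient_class_zero[OF Z, of v] that by (simp add: P P.quotient_zero)
  have "simple_module (uq q) (quotient_module P {\<zero>\<^bsub>A\<^esub>})"
  proof (rule Q.simple_moduleI)
    show "{\<zero>\<^bsub>A\<^esub>} +>\<^bsub>P\<^esub> \<one>\<^bsub>A\<^esub> \<in> carrier (quotient_module P {\<zero>\<^bsub>A\<^esub>})"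
      using one by (auto simp: P.quotient_carrier P)
    show "{\<zero>\<^bsub>A\<^esub>} +>\<^bsub>P\<^esub> \<one>\<^bsub>A\<^esub> \<noteq> \<zero>\<^bsub>quotient_module P {\<zero>\<^bsub>A\<^esub>}\<^esub>"
      using zero[OF one] one_nonzero by simp
    fix u v assume "u \<in> carrier (quotient_module P {\<zero>\<^bsub>A\<^esub>})" "v \<in> carrier (quotient_module P {\<zero>\<^bsub>A\<^esub>})"
      and v0: "v \<noteq> \<zero>\<^bsub>quotient_module P {\<zero>\<^bsub>A\<^esub>}\<^esub>"
    then obtain a b where u: "u = {\<zero>\<^bsub>A\<^esub>} +>\<^bsub>P\<^esub> scale a \<one>\<^bsub>A\<^esub>" and v: "v = {\<zero>\<^bsub>A\<^esub>} +>\<^bsub>P\<^esub> scale b \<one>\<^bsub>A\<^esub>"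
      by (auto simp: P.quotient_carrier P J0_def)
    have bJ: "scale b \<one>\<^bsub>A\<^esub> \<in> J0" by (simp add: J0_def)
    then have "b \<noteq> 0" using v v0 zero by auto
    then have "scale a \<one>\<^bsub>A\<^esub> = uq_class q (scal (a / b)) \<odot>\<^bsub>P\<^esub> scale b \<one>\<^bsub>A\<^esub>"
      using scale_scale[of "\<one>\<^bsub>A\<^esub>" "a / b" b] by (simp add: P act_eq)
    then have "u = uq_class q (scal (a / b)) \<odot>\<^bsub>quotient_module P {\<zero>\<^bsub>A\<^esub>}\<^esub> v"
      unfolding u v using bJ P.quotient_smult[OF Z, of "uq_class q (scal (a / b))" "scale b \<one>\<^bsub>A\<^esub>"]
      by (simp add: P)
    then show "\<exists>h\<in>carrier (uq q). u = h \<odot>\<^bsub>quotient_module P {\<zero>\<^bsub>A\<^esub>}\<^esub> v" by blast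
  qed
  then show ?thesis by (simp add: P_def)
qed

lemma V0_composition_series: "composition_series (uq q) M0 [{\<zero>\<^bsub>A\<^esub>}, J0, V 0]"
proof -
  have "\<zero>\<^bsub>A\<^esub> \<in> J0" "J0 \<subseteq> V 0" using M0.submoduleD(1,2)[OF J0_submodule] by simp_all
  moreover have "\<one>\<^bsub>A\<^esub> \<in> J0" unfolding J0_def by (rule range_eqI[of _ _ 1]) simp
  moreover have "Y \<in> V 0" "Y \<notin> J0" using raised_in_V0[of 0] F_J0[of Y] F_Y_nonzero by auto
  ultimately have "{\<zero>\<^bsub>A\<^esub>} \<subset> J0" "J0 \<subset> V 0" using one_nonzero by auto
  moreover have "submodule {\<zero>\<^bsub>A\<^esub>} (uq q) M0" using M0.zero_submodule by simp
  moreover have "submodule (V 0) (uq q) M0"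
    by (rule submodule_restrict[OF V0_submodule V0_submodule]) simp
  moreover have "simple_module (uq q) M0_quotient"
    using cyclic_lowest_weight.simple[OF quotient_cyclic] .
  ultimately show ?thesis
    using J0_simple J0_submodule
    by (auto simp: composition_series_def less_Suc_eq numeral_eq_Suc nth_Cons')
qed

end

section \<open>The theorem\<close>

(* The submodule generated by x^0 = 1 is the line spanned by 1, since h(1) is the counit of h
   times 1; it is J0, not V 0. Hence generation of V n by x^n is stated for n >= 1 only. *)
theorem proposition23:
  fixes q d0 s t :: complex
    and \<pi> :: "uq_gen free_alg set \<Rightarrow> qplane_gen free_alg set \<Rightarrow> qplane_gen free_alg set"
  assumes q_nonzero: "q \<noteq> 0"
    and q_not_root_of_unity: "\<forall>n::nat. n > 0 \<longrightarrow> q ^ n \<noteq> 1"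
    and d0_nonzero: "d0 \<noteq> 0"
    and module_algebra: "uq_module_algebra q (qplane q) \<pi>"
    and k_x: "\<pi> (uq_k q) (qplane_x q) = q \<odot>\<^bsub>qplane q\<^esub> qplane_x q"
    and k_y: "\<pi> (uq_k q) (qplane_y q) = q\<^sup>2 \<odot>\<^bsub>qplane q\<^esub> qplane_y q"
    and e_x: "\<pi> (uq_e q) (qplane_x q) =
      ((- q * inverse d0) \<odot>\<^bsub>qplane q\<^esub> (qplane_x q \<otimes>\<^bsub>qplane q\<^esub> qplane_y q))
      \<oplus>\<^bsub>qplane q\<^esub> (s \<odot>\<^bsub>qplane q\<^esub> (qplane_x q [^]\<^bsub>qplane q\<^esub> (3::nat)))"
    and e_y: "\<pi> (uq_e q) (qplane_y q) =
      ((- q * inverse d0) \<odot>\<^bsub>qplane q\<^esub> (qplane_y q [^]\<^bsub>qplane q\<^esub> (2::nat)))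
      \<oplus>\<^bsub>qplane q\<^esub> (t \<odot>\<^bsub>qplane q\<^esub> (qplane_x q [^]\<^bsub>qplane q\<^esub> (4::nat)))"
    and f_x: "\<pi> (uq_f q) (qplane_x q) = \<zero>\<^bsub>qplane q\<^esub>"
    and f_y: "\<pi> (uq_f q) (qplane_y q) = d0 \<odot>\<^bsub>qplane q\<^esub> \<one>\<^bsub>qplane q\<^esub>"
  shows "let M = rep_module (qplane q) \<pi>;
             J0 = {c \<odot>\<^bsub>qplane q\<^esub> \<one>\<^bsub>qplane q\<^esub> | c. True}
         in \<exists>V :: nat \<Rightarrow> qplane_gen free_alg set set.
           internal_direct_sum (uq q) M V \<and>
           (\<forall>n. lowest_weight_vector q (M\<lparr>carrier := V n\<rparr>) (q ^ n) (qplane_x q [^]\<^bsub>qplane q\<^esub> n)) \<and>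
           (\<forall>n\<ge>1. V n = generated_submodule (uq q) M {qplane_x q [^]\<^bsub>qplane q\<^esub> n}) \<and>
           (\<forall>n\<ge>1. module_isomorphic (uq q) (M\<lparr>carrier := V n\<rparr>) (verma q (q ^ n)) \<and>
                   simple_module (uq q) (verma q (q ^ n))) \<and>
           composition_series (uq q) (M\<lparr>carrier := V 0\<rparr>) [{\<zero>\<^bsub>M\<^esub>}, J0, V 0] \<and>
           \<not> direct_summand (uq q) (M\<lparr>carrier := V 0\<rparr>) J0 \<and>
           module_isomorphic (uq q) (quotient_module (M\<lparr>carrier := V 0\<rparr>) J0) (verma q (q\<^sup>2)) \<and>
           simple_module (uq q) (verma q (q\<^sup>2))"
proof -
  interpret qplane_action q d0 \<pi>
    using assms by unfold_locales auto
  have x: "qplane_x q = X" by (simp add: qplane_x_def)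
  have J: "{c \<odot>\<^bsub>qplane q\<^esub> \<one>\<^bsub>qplane q\<^esub> | c. True} = J0"
    by (auto simp: J0_def scale_eq)
  show ?thesis
    unfolding Let_def J x M_simps(2)
  proof (intro exI[of _ V] conjI allI impI)
    fix n :: nat assume n: "n \<ge> 1"
    note C = V_cyclic(1)[OF n]
    show "module_isomorphic (uq q) (M\<lparr>carrier := V n\<rparr>) (verma q (q ^ n))"
      by (rule cyclic_lowest_weight.isomorphic_verma[OF C])
    show "simple_module (uq q) (verma q (q ^ n))"
      by (rule cyclic_lowest_weight.verma_simple[OF C])
  next
    show "module_isomorphic (uq q) M0_quotient (verma q (q\<^sup>2))"
      by (rule cyclic_lowest_weight.isomorphic_verma[OF quotient_cyclic])
    show "simple_module (uq q) (verma q (q\<^sup>2))"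
      by (rule cyclic_lowest_weight.verma_simple[OF quotient_cyclic])
  qed (rule plane_direct_sum V_lowest_weight_vector V_cyclic(2) V0_composition_series
      J0_not_direct_summand | assumption)+
qed

end
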